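(* Let $u,v,w$ be nonconstant inner functions and let $\phi_1,\phi_2\in L^2$ be such that the operators $B^{v,w}_{\phi_1}$ and $B^{u,v}_{\phi_2}$ are bounded. Then the following are equivalent: (1) $B^{v,w}_{\phi_1}B^{u,v}_{\phi_2}\in\mathcal{H}(u,w)$; (2) $A^{\widehat{v},w}_{w\widehat{\phi_1}}A^{u,\widehat{v}}_{\overline{u\phi_2}}\in\mathcal{H}(u,w)$; (3) $A^{v,\widehat{w}}_{\overline{v\phi_1}}A^{\widehat{u},v}_{v\widehat{\phi_2}}\in\mathcal{H}(\widehat{u},\widehat{w})$; (4) $A^{v,\widehat{w}}_{\overline{v\phi_1}}B^{u,v}_{\overline{u\widehat{v}\phi_2}}\in\mathcal{T}(u,\widehat{w})$.
   Context: $L^2=L^2(\mathbb{T})$, $H^2\subset L^2$ is the Hardy space of the unit disk $\mathbb{D}$ (via boundary values), and $P:L^2\to H^2$ is the orthogonal projection. An inner function is $u\in H^2$ with $|u|=1$ a.e. on $\mathbb{T}$. The model space is $K_u=H^2\ominus uH^2$, and $P_u:L^2\to K_u$ is the orthogonal projection. For $f\in L^2$, $\widehat f(z)=\overline{f(\overline z)}$, $|z|=1$; if $u$ is inner, so is $\widehat u$. The flip operator is $J:L^2\to L^2$, $Jf(z)=\overline z f(\overline z)$, $|z|=1$. For inner functions $u,v$ and $\phi\in L^2$, the asymmetric truncated Toeplitz operator $A^{u,v}_\phi$ and the asymmetric truncated Hankel operator $B^{u,v}_\phi$ are the densely defined operators from $K_u$ into $K_v$ given by $A^{u,v}_\phi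 f=P_v(\phi f)$ and $B^{u,v}_\phi f=P_vJ(I-P)(\phi f)$ (defined at least on the bounded functions in $K_u$, which are dense; when bounded, they are extended to all of $K_u$). $\mathcal{T}(u,v)$ is the space of all bounded operators of the form $A^{u,v}_\phi$, $\phi\in L^2$, and $\mathcal{H}(u,v)$ is the space of all bounded operators of the form $B^{u,v}_\phi$, $\phi\in L^2$. *)

theory Defs
  imports "HOL-Analysis.Analysis"
begin

section \<open>The Hilbert space of square-integrable functions on the unit circle\<close>

text \<open>Normalized arc length on the unit circle, as a measure whose space is the circle itself.\<close>

definition circle :: "complex measure" where
  "circle = distr (uniform_measure lborel {0..2*pi}) (restrict_space borel (sphere 0 1)) cis"

lemma sets_circle [measurable_cong]: "sets circle = sets (restrict_space borel (sphere 0 1))"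
  by (simp add: circle_def)

lemma space_circle: "space circle = sphere 0 1"
  by (simp add: circle_def space_restrict_space)

lemma cis_measurable [measurable]:
  "cis \<in> uniform_measure lborel {0..2*pi} \<rightarrow>\<^sub>M restrict_space borel (sphere 0 1)"
proof -
  have "continuous_on UNIV cis" by (intro continuous_intros)
  then have "cis \<in> borel \<rightarrow>\<^sub>M borel" by (rule borel_measurable_continuous_onI)
  then show ?thesis
    by (intro measurable_restrict_space2) (auto simp: measurable_def)
qed

interpretation circle: finite_measure circle
proof
  have "space circle \<in> sets (restrict_space borel (sphere 0 1))"
    using sets.top[of circle] by (simp add: sets_circle)
  moreover have "cis -` space circle \<inter> space (uniform_measure lborel {0..2*pi}) = UNIV"
    by (auto simp: space_circle)
  ultimately have "emeasure circle (space circle) = emeasure (uniform_measure lborel {0..2*pi}) UNIV"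
    unfolding circle_def by (subst emeasure_distr[OF cis_measurable]) (auto simp: circle_def[symmetric])
  also have "\<dots> \<noteq> \<infinity>" by (subst emeasure_uniform_measure) (auto simp: divide_ennreal)
  finally show "emeasure circle (space circle) \<noteq> \<infinity>" .
qed

lemma cnj_measurable_circle [measurable]: "cnj \<in> circle \<rightarrow>\<^sub>M circle"
  unfolding measurable_cong_sets[OF sets_circle sets_circle]
  by (intro measurable_restrict_space3) (auto intro!: borel_measurable_continuous_onI continuous_intros)

lemma distr_circle_cnj: "distr circle circle cnj = circle"
proof -
  let ?U = "uniform_measure lborel {0..2*pi}"
  let ?r = "\<lambda>t::real. 2*pi + (-1) * t"
  have rM [measurable]: "?r \<in> borel \<rightarrow>\<^sub>M borel" by measurable
  then have rA: "?r -` A \<in> sets borel" if "A \<in> sets borel" for A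
    using that by (rule measurable_sets_borel)
  have r: "?r \<in> ?U \<rightarrow>\<^sub>M ?U"
    using rM by (simp add: measurable_def)
  have lb: "distr lborel borel ?r = lborel"
    using lborel_real_affine[of "-1" "2*pi"] by (simp add: density_1)
  have rU: "distr ?U ?U ?r = ?U"
  proof (rule measure_eqI)
    fix A assume "A \<in> sets (distr ?U ?U ?r)"
    then have A: "A \<in> sets borel" by simp
    have "emeasure (distr ?U ?U ?r) A = emeasure ?U (?r -` A)"
      using A r by (subst emeasure_distr) auto
    also have "\<dots> = emeasure lborel ({0..2*pi} \<inter> ?r -` A) / emeasure lborel {0..2*pi}"
      using A rA[OF A] by (subst emeasure_uniform_measure) auto
    also have "{0..2*pi} \<inter> ?r -` A = ?r -` ({0..2*pi} \<inter> A)" by auto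
    also have "emeasure lborel \<dots> = emeasure (distr lborel borel ?r) ({0..2*pi} \<inter> A)"
      using A rM by (subst emeasure_distr) auto
    also have "\<dots> / emeasure lborel {0..2*pi} = emeasure ?U A"
      unfolding lb using A by (subst emeasure_uniform_measure) auto
    finally show "emeasure (distr ?U ?U ?r) A = emeasure ?U A" .
  qed simp
  have cis: "cis \<in> ?U \<rightarrow>\<^sub>M circle"
    using cis_measurable measurable_cong_sets[OF refl sets_circle] by blast
  have c: "circle = distr ?U circle cis"
    using distr_cong[OF refl sets_circle[symmetric], of ?U cis cis] by (simp add: circle_def)
  have "distr circle circle cnj = distr ?U circle (cnj \<circ> cis)"
    using cis by (subst c) (simp add: distr_distr)
  also have "cnj \<circ> cis = cis \<circ> ?r"
    by (auto simp: fun_eq_iff complex_eq_iff cos_diff sin_diff)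
  also have "distr ?U circle (cis \<circ> ?r) = distr (distr ?U ?U ?r) circle cis"
    using cis r by (simp add: distr_distr)
  also have "\<dots> = circle" unfolding rU c[symmetric] ..
  finally show ?thesis .
qed

definition square_integrable :: "(complex \<Rightarrow> complex) set" where
  "square_integrable =
    {f \<in> borel_measurable circle. integrable circle (\<lambda>z. (cmod (f z))\<^sup>2)}"

lemma measurable_cnj:
  assumes "f \<in> borel_measurable M"
  shows "(\<lambda>z. cnj (f z)) \<in> borel_measurable M"
proof -
  have "cnj \<in> borel \<rightarrow>\<^sub>M borel"
    by (intro borel_measurable_continuous_onI continuous_intros)
  with assms show ?thesis by (rule measurable_compose)
qed

lemma square_integrable_prod:
  assumes "f \<in> square_integrable" "g \<in> square_integrable"
  shows "integrable circle (\<lambda>z. f z * cnj (g z))"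
proof (rule Bochner_Integration.integrable_bound)
  show "integrable circle (\<lambda>z. (cmod (f z))\<^sup>2 + (cmod (g z))\<^sup>2)"
    using assms by (auto simp: square_integrable_def)
  show "(\<lambda>z. f z * cnj (g z)) \<in> borel_measurable circle"
    using assms by (intro borel_measurable_times measurable_cnj) (auto simp: square_integrable_def)
  have "cmod (f z) * cmod (g z) \<le> (cmod (f z))\<^sup>2 + (cmod (g z))\<^sup>2" for z
  proof -
    have "2 * (cmod (f z) * cmod (g z)) \<le> (cmod (f z))\<^sup>2 + (cmod (g z))\<^sup>2"
      using sum_squares_bound[of "cmod (f z)" "cmod (g z)"] by (simp add: mult.assoc)
    moreover have "0 \<le> cmod (f z) * cmod (g z)" by simp
    ultimately show ?thesis by linarith
  qed
  then show "AE z in circle. norm (f z * cnj (g z)) \<le> norm ((cmod (f z))\<^sup>2 + (cmod (g z))\<^sup>2)"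
    by (simp add: norm_mult)
qed

lemma square_integrable_dominated:
  assumes "f \<in> borel_measurable circle" "g \<in> square_integrable"
    and "\<And>z. cmod (f z) \<le> c * cmod (g z)"
  shows "f \<in> square_integrable"
proof -
  have "integrable circle (\<lambda>z. (cmod (f z))\<^sup>2)"
  proof (rule Bochner_Integration.integrable_bound)
    show "integrable circle (\<lambda>z. c\<^sup>2 * (cmod (g z))\<^sup>2)"
      using assms(2) by (auto simp: square_integrable_def)
    show "AE z in circle. norm ((cmod (f z))\<^sup>2) \<le> norm (c\<^sup>2 * (cmod (g z))\<^sup>2)"
      using power_mono[OF assms(3), where n = 2] by (simp add: power_mult_distrib)
  qed (use assms in measurable)
  then show ?thesis using assms by (auto simp: square_integrable_def)
qed

lemma square_integrable_add:
  assumes "f \<in> square_integrable" "g \<in> square_integrable"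
  shows "(\<lambda>z. f z + g z) \<in> square_integrable"
proof -
  have "integrable circle (\<lambda>z. (cmod (f z + g z))\<^sup>2)"
  proof (rule Bochner_Integration.integrable_bound)
    show "integrable circle (\<lambda>z. 2 * (cmod (f z))\<^sup>2 + 2 * (cmod (g z))\<^sup>2)"
      using assms by (auto simp: square_integrable_def)
    show "(\<lambda>z. (cmod (f z + g z))\<^sup>2) \<in> borel_measurable circle"
      using assms by (auto simp: square_integrable_def)
    have "(cmod (f z + g z))\<^sup>2 \<le> 2 * (cmod (f z))\<^sup>2 + 2 * (cmod (g z))\<^sup>2" for z
    proof -
      have "(cmod (f z + g z))\<^sup>2 \<le> (cmod (f z) + cmod (g z))\<^sup>2"
        by (intro power_mono norm_triangle_ineq) auto
      also have "\<dots> \<le> 2 * (cmod (f z))\<^sup>2 + 2 * (cmod (g z))\<^sup>2"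
        using sum_squares_bound[of "cmod (f z)" "cmod (g z)"] by (simp add: power2_sum)
      finally show ?thesis .
    qed
    then show "AE z in circle. norm ((cmod (f z + g z))\<^sup>2)
        \<le> norm (2 * (cmod (f z))\<^sup>2 + 2 * (cmod (g z))\<^sup>2)" by simp
  qed
  then show ?thesis using assms by (auto simp: square_integrable_def)
qed

lemma square_integrable_scale:
  assumes "f \<in> square_integrable"
  shows "(\<lambda>z. c * f z) \<in> square_integrable"
proof (rule square_integrable_dominated[OF _ assms])
  show "(\<lambda>z. c * f z) \<in> borel_measurable circle"
    using assms by (intro borel_measurable_times measurable_const) (simp_all add: square_integrable_def)
  show "cmod (c * f z) \<le> cmod c * cmod (f z)" for z
    by (simp add: norm_mult)
qed

lemma square_integrable_cnj:
  assumes "f \<in> square_integrable"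
  shows "(\<lambda>z. cnj (f z)) \<in> square_integrable"
  using assms by (simp add: square_integrable_def measurable_cnj)

lemma square_integrable_const: "(\<lambda>_. c) \<in> square_integrable"
  by (simp add: square_integrable_def)

lemma square_integrable_reflect:
  assumes "f \<in> square_integrable"
  shows "(\<lambda>z. f (cnj z)) \<in> square_integrable"
proof -
  have "integrable (distr circle circle cnj) (\<lambda>z. (cmod (f z))\<^sup>2)"
    using assms by (simp add: distr_circle_cnj square_integrable_def)
  then have "integrable circle (\<lambda>z. (cmod (f (cnj z)))\<^sup>2)"
    by (rule integrable_distr[OF cnj_measurable_circle])
  moreover have "(\<lambda>z. f (cnj z)) \<in> borel_measurable circle"
    using assms by (intro measurable_compose[OF cnj_measurable_circle])
      (auto simp: square_integrable_def)
  ultimately show ?thesis by (simp add: square_integrable_def)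
qed

lemma AE_circle_cnj:
  assumes "AE z in circle. P z"
  shows "AE z in circle. P (cnj z)"
proof -
  have "AE z in distr circle circle cnj. P z" using assms unfolding distr_circle_cnj .
  then show ?thesis by (rule AE_distrD[OF cnj_measurable_circle])
qed

definition AE_equal :: "(complex \<Rightarrow> complex) \<Rightarrow> (complex \<Rightarrow> complex) \<Rightarrow> bool" where
  "AE_equal f g \<longleftrightarrow>
    f \<in> square_integrable \<and> g \<in> square_integrable \<and> (AE z in circle. f z = g z)"

lemma part_equivp_AE_equal: "part_equivp AE_equal"
proof (rule part_equivpI)
  show "\<exists>f. AE_equal f f"
    by (rule exI[of _ "\<lambda>_. 0"]) (simp add: AE_equal_def square_integrable_const)
  show "symp AE_equal"
  proof (rule sympI)
    fix f g assume *: "AE_equal f g"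
    then have "AE z in circle. f z = g z" by (simp add: AE_equal_def)
    then have "AE z in circle. g z = f z" by eventually_elim simp
    with * show "AE_equal g f" by (simp add: AE_equal_def)
  qed
  show "transp AE_equal"
  proof (rule transpI)
    fix f g h assume *: "AE_equal f g" "AE_equal g h"
    then have "AE z in circle. f z = g z" "AE z in circle. g z = h z" by (simp_all add: AE_equal_def)
    then have "AE z in circle. f z = h z" by eventually_elim simp
    with * show "AE_equal f h" by (simp add: AE_equal_def)
  qed
qed

lemma AE_equal_D:
  assumes "AE_equal f g"
  shows "f \<in> square_integrable" "g \<in> square_integrable" "AE z in circle. f z = g z"
  using assms by (simp_all add: AE_equal_def)

lemma AE_equal_pointwise:
  assumes "f \<in> square_integrable" "\<And>z. f z = g z"
  shows "AE_equal f g"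
proof -
  have "f = g" using assms(2) by (rule ext)
  with assms(1) show ?thesis by (simp add: AE_equal_def)
qed

lemma AE_equal_add:
  assumes "AE_equal f f'" "AE_equal g g'"
  shows "AE_equal (\<lambda>z. f z + g z) (\<lambda>z. f' z + g' z)"
proof -
  have "AE z in circle. f z + g z = f' z + g' z"
    using AE_equal_D(3)[OF assms(1)] AE_equal_D(3)[OF assms(2)] by eventually_elim simp
  then show ?thesis
    using assms by (simp add: AE_equal_def square_integrable_add)
qed

lemma AE_equal_scale:
  assumes "AE_equal f f'"
  shows "AE_equal (\<lambda>z. c * f z) (\<lambda>z. c * f' z)"
proof -
  have "AE z in circle. c * f z = c * f' z"
    using AE_equal_D(3)[OF assms(1)] by eventually_elim simp
  then show ?thesis
    using assms by (simp add: AE_equal_def square_integrable_scale)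
qed

quotient_type L2 = "complex \<Rightarrow> complex" / partial: AE_equal
  by (rule part_equivp_AE_equal)

instantiation L2 :: real_vector
begin

lift_definition zero_L2 :: L2 is "\<lambda>_. 0"
  by (simp add: AE_equal_def square_integrable_const)

lift_definition plus_L2 :: "L2 \<Rightarrow> L2 \<Rightarrow> L2" is "\<lambda>f g z. f z + g z"
  by (rule AE_equal_add)

lift_definition uminus_L2 :: "L2 \<Rightarrow> L2" is "\<lambda>f z. - f z"
  using AE_equal_scale[where c = "-1"] by simp

lift_definition minus_L2 :: "L2 \<Rightarrow> L2 \<Rightarrow> L2" is "\<lambda>f g z. f z - g z"
  using AE_equal_add[OF _ AE_equal_scale[where c = "-1"]] by simp

lift_definition scaleR_L2 :: "real \<Rightarrow> L2 \<Rightarrow> L2" is "\<lambda>c f z. of_real c * f z"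
  by (rule AE_equal_scale)

instance
proof
  note si = square_integrable_add square_integrable_scale square_integrable_const AE_equal_D(1)
  fix f g h :: L2 and a b :: real
  show "f + g + h = f + (g + h)"
    by transfer (rule AE_equal_pointwise, intro si, auto)
  show "f + g = g + f"
    by transfer (rule AE_equal_pointwise, intro si, auto)
  show "0 + f = f"
    by transfer (rule AE_equal_pointwise, intro si, auto)
  show "- f + f = 0"
    by transfer (rule AE_equal_pointwise, simp_all add: square_integrable_const)
  show "f - g = f + - g"
    by transfer (rule AE_equal_pointwise,
        use square_integrable_add[OF _ square_integrable_scale[where c = "-1"]] in
          \<open>simp_all add: AE_equal_def\<close>)
  show "a *\<^sub>R (f + g) = a *\<^sub>R f + a *\<^sub>R g"
    by transfer (rule AE_equal_pointwise, intro si, auto simp: algebra_simps)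
  show "(a + b) *\<^sub>R f = a *\<^sub>R f + b *\<^sub>R f"
    by transfer (rule AE_equal_pointwise, intro si, auto simp: algebra_simps)
  show "a *\<^sub>R b *\<^sub>R f = (a * b) *\<^sub>R f"
    by transfer (rule AE_equal_pointwise, intro si, auto simp: algebra_simps)
  show "1 *\<^sub>R f = f"
    by transfer (rule AE_equal_pointwise, intro si, auto)
qed

end

lift_definition cinner :: "L2 \<Rightarrow> L2 \<Rightarrow> complex" is
  "\<lambda>f g. \<integral>z. f z * cnj (g z) \<partial>circle"
proof -
  fix f f' g g' assume fg: "AE_equal f f'" "AE_equal g g'"
  have "AE z in circle. f z * cnj (g z) = f' z * cnj (g' z)"
    using AE_equal_D(3)[OF fg(1)] AE_equal_D(3)[OF fg(2)] by eventually_elim simp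
  with fg show "?thesis f f' g g'"
    by (intro integral_cong_AE borel_measurable_integrable square_integrable_prod)
      (simp_all add: AE_equal_def)
qed

instantiation L2 :: real_inner
begin

definition inner_L2 :: "L2 \<Rightarrow> L2 \<Rightarrow> real" where "inner_L2 f g = Re (cinner f g)"
definition norm_L2 :: "L2 \<Rightarrow> real" where "norm_L2 f = sqrt (inner f f)"
definition dist_L2 :: "L2 \<Rightarrow> L2 \<Rightarrow> real" where "dist_L2 f g = norm (f - g)"
definition sgn_L2 :: "L2 \<Rightarrow> L2" where "sgn_L2 f = inverse (norm f) *\<^sub>R f"
definition uniformity_L2 :: "(L2 \<times> L2) filter" where
  "uniformity_L2 = (INF e\<in>{0<..}. principal {(x, y). dist x y < e})"
definition open_L2 :: "L2 set \<Rightarrow> bool" where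
  "open_L2 U \<longleftrightarrow> (\<forall>x\<in>U. eventually (\<lambda>(x', y). x' = x \<longrightarrow> y \<in> U) uniformity)"

instance
proof
  fix f g h :: L2 and r :: real
  show "inner f g = inner g f"
    unfolding inner_L2_def
  proof transfer
    fix f g :: "complex \<Rightarrow> complex"
    have "(\<integral>z. g z * cnj (f z) \<partial>circle) = cnj (\<integral>z. f z * cnj (g z) \<partial>circle)"
      using Bochner_Integration.integral_cnj[of circle "\<lambda>z. f z * cnj (g z)"] by (simp add: mult.commute)
    then show "Re (\<integral>z. f z * cnj (g z) \<partial>circle) = Re (\<integral>z. g z * cnj (f z) \<partial>circle)" by simp
  qed
  show "inner (f + g) h = inner f h + inner g h"
    unfolding inner_L2_def
    by transfer (simp add: distrib_right square_integrable_prod AE_equal_D(1))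
  show "inner (r *\<^sub>R f) g = r * inner f g"
    unfolding inner_L2_def by transfer (simp add: mult.assoc)
  have sq: "Re (\<integral>z. f z * cnj (f z) \<partial>circle) = (\<integral>z. (cmod (f z))\<^sup>2 \<partial>circle)"
    for f :: "complex \<Rightarrow> complex"
  proof -
    have "(\<integral>z. f z * cnj (f z) \<partial>circle) = (\<integral>z. complex_of_real ((cmod (f z))\<^sup>2) \<partial>circle)"
      by (intro Bochner_Integration.integral_cong) (auto simp: complex_mult_cnj cmod_power2)
    then show ?thesis by (simp only: integral_complex_of_real Re_complex_of_real)
  qed
  show "0 \<le> inner f f"
    unfolding inner_L2_def by transfer (simp add: sq)
  show "inner f f = 0 \<longleftrightarrow> f = 0"
    unfolding inner_L2_def
  proof transfer
    fix f assume "AE_equal f f"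
    then have f: "f \<in> square_integrable" by (rule AE_equal_D)
    then have "(\<integral>z. (cmod (f z))\<^sup>2 \<partial>circle) = 0 \<longleftrightarrow> (AE z in circle. (cmod (f z))\<^sup>2 = 0)"
      by (intro integral_nonneg_eq_0_iff_AE) (auto simp: square_integrable_def)
    then show "(Re (\<integral>z. f z * cnj (f z) \<partial>circle) = 0) = AE_equal f (\<lambda>_. 0)"
      using f by (simp add: sq square_integrable_const AE_equal_def)
  qed
qed (simp_all add: norm_L2_def dist_L2_def sgn_L2_def uniformity_L2_def open_L2_def)

end

lift_definition L2_const :: "complex \<Rightarrow> L2" is "\<lambda>c _. c"
  by (simp add: AE_equal_def square_integrable_const)

text \<open>
  The pointwise product of two square-integrable functions need not be square-integrable; in that
  case the value is the junk value 0. Below, at least one factor is always essentially bounded, so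
  that the product is the genuine one.
\<close>

lift_definition L2_mult :: "L2 \<Rightarrow> L2 \<Rightarrow> L2" (infixl "\<cdot>" 70) is
  "\<lambda>f g. if (\<lambda>z. f z * g z) \<in> square_integrable then (\<lambda>z. f z * g z) else (\<lambda>_. 0)"
proof -
  fix f f' g g' assume fg: "AE_equal f f'" "AE_equal g g'"
  have ae: "AE z in circle. f z * g z = f' z * g' z"
    using AE_equal_D(3)[OF fg(1)] AE_equal_D(3)[OF fg(2)] by eventually_elim simp
  have meas: "(\<lambda>z. f z * g z) \<in> borel_measurable circle"
      "(\<lambda>z. f' z * g' z) \<in> borel_measurable circle"
    using fg by (auto simp: AE_equal_def square_integrable_def)
  have ae2: "AE z in circle. (cmod (f z * g z))\<^sup>2 = (cmod (f' z * g' z))\<^sup>2"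
    using ae by eventually_elim simp
  have "integrable circle (\<lambda>z. (cmod (f z * g z))\<^sup>2) \<longleftrightarrow>
      integrable circle (\<lambda>z. (cmod (f' z * g' z))\<^sup>2)"
    by (rule integrable_cong_AE[OF _ _ ae2]) (use meas in measurable)
  then have "(\<lambda>z. f z * g z) \<in> square_integrable \<longleftrightarrow> (\<lambda>z. f' z * g' z) \<in> square_integrable"
    using meas by (simp add: square_integrable_def)
  with ae show "?thesis f f' g g'"
    by (simp add: AE_equal_def square_integrable_const)
qed

lift_definition L2_cnj :: "L2 \<Rightarrow> L2" is "\<lambda>f z. cnj (f z)"
proof -
  fix f g assume fg: "AE_equal f g"
  have "AE z in circle. cnj (f z) = cnj (g z)"
    using AE_equal_D(3)[OF fg] by eventually_elim simp
  with fg show "?thesis f g" by (simp add: AE_equal_def square_integrable_cnj)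
qed

lift_definition L2_hat :: "L2 \<Rightarrow> L2" is "\<lambda>f z. cnj (f (cnj z))"
proof -
  fix f g assume fg: "AE_equal f g"
  have "AE z in circle. cnj (f (cnj z)) = cnj (g (cnj z))"
    using AE_circle_cnj[OF AE_equal_D(3)[OF fg]] by eventually_elim simp
  with fg show "?thesis f g"
    by (simp add: AE_equal_def square_integrable_cnj square_integrable_reflect)
qed

lift_definition flip :: "L2 \<Rightarrow> L2" is "\<lambda>f z. cnj z * f (cnj z)"
proof -
  fix f g assume fg: "AE_equal f g"
  have ae: "AE z in circle. cnj z * f (cnj z) = cnj z * g (cnj z)"
    using AE_circle_cnj[OF AE_equal_D(3)[OF fg]] by eventually_elim simp
  have id: "(\<lambda>z. z) \<in> borel_measurable circle"
    unfolding measurable_cong_sets[OF sets_circle refl] by (rule measurable_restrict_space1) simp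
  have *: "(\<lambda>z. cnj z * h (cnj z)) \<in> square_integrable" if "h \<in> square_integrable" for h
  proof -
    have h: "(\<lambda>z. h (cnj z)) \<in> square_integrable" using that by (rule square_integrable_reflect)
    have "integrable circle (\<lambda>z. (cmod (h (cnj z)))\<^sup>2) \<longleftrightarrow>
        integrable circle (\<lambda>z. (cmod (cnj z * h (cnj z)))\<^sup>2)"
      by (intro Bochner_Integration.integrable_cong) (simp_all add: space_circle norm_mult)
    moreover have "(\<lambda>z. cnj z * h (cnj z)) \<in> borel_measurable circle"
      using h by (intro borel_measurable_times measurable_cnj id) (simp add: square_integrable_def)
    ultimately show ?thesis using h by (simp add: square_integrable_def)
  qed
  show "?thesis f g"
    using fg ae by (simp add: AE_equal_def *)
qed

lift_definition essentially_bounded :: "L2 \<Rightarrow> bool" is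
  "\<lambda>f. \<exists>C. AE z in circle. cmod (f z) \<le> C"
proof -
  have *: "\<exists>C. AE z in circle. cmod (g z) \<le> C"
    if fg: "AE z in circle. f z = g z" and f: "\<exists>C. AE z in circle. cmod (f z) \<le> C"
    for f g :: "complex \<Rightarrow> complex"
  proof -
    obtain C where "AE z in circle. cmod (f z) \<le> C" using f ..
    with fg have "AE z in circle. cmod (g z) \<le> C" by eventually_elim simp
    then show ?thesis ..
  qed
  fix f g assume fg: "AE_equal f g"
  then have gf: "AE_equal g f" by (rule part_equivp_symp[OF part_equivp_AE_equal])
  show "?thesis f g"
    using *[OF AE_equal_D(3)[OF fg]] *[OF AE_equal_D(3)[OF gf]] by blast
qed

lift_definition unimodular :: "L2 \<Rightarrow> bool" is
  "\<lambda>f. AE z in circle. cmod (f z) = 1"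
proof -
  fix f g assume fg: "AE_equal f g"
  have "AE z in circle. (cmod (f z) = 1) = (cmod (g z) = 1)"
    using AE_equal_D(3)[OF fg] by eventually_elim simp
  then show "?thesis f g" by (rule eventually_subst)
qed


section \<open>Hardy space, inner functions and model spaces\<close>

definition hardy_disk :: "(complex \<Rightarrow> complex) set" where
  "hardy_disk = {F. F holomorphic_on ball 0 1 \<and>
    (\<exists>C. \<forall>r\<in>{0..<1}. (\<integral>z. (cmod (F (of_real r * z)))\<^sup>2 \<partial>circle) \<le> C)}"

text \<open>
  The boundary function of \<open>F\<close> is the limit, in the mean-square sense, of the dilates
  \<open>z \<mapsto> F (r * z)\<close> as \<open>r \<rightarrow> 1-\<close>; it is also the almost everywhere radial limit.
\<close>

definition H2 :: "L2 set" where
  "H2 = {f. \<exists>F\<in>hardy_disk. ((\<lambda>r. abs_L2 (\<lambda>z. F (of_real r * z))) \<longlongrightarrow> f) (at_left 1)}"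

definition inner_function :: "L2 \<Rightarrow> bool" where
  "inner_function u \<longleftrightarrow> u \<in> H2 \<and> unimodular u"

definition nonconstant :: "L2 \<Rightarrow> bool" where
  "nonconstant u \<longleftrightarrow> (\<forall>c. u \<noteq> L2_const c)"

definition orth_proj :: "L2 set \<Rightarrow> L2 \<Rightarrow> L2" where
  "orth_proj S f = (THE g. g \<in> S \<and> (\<forall>h\<in>S. cinner (f - g) h = 0))"

definition model_space :: "L2 \<Rightarrow> L2 set" where
  "model_space u = {f \<in> H2. \<forall>g\<in>H2. cinner f (u \<cdot> g) = 0}"

definition bounded_model_space :: "L2 \<Rightarrow> L2 set" where
  "bounded_model_space u = {f \<in> model_space u. essentially_bounded f}"


section \<open>Asymmetric truncated Toeplitz and Hankel operators\<close>

text \<open>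
  An operator is first given on the dense subspace \<open>bounded_model_space u\<close> of \<open>model_space u\<close>.
  When it is bounded there, its value on all of \<open>model_space u\<close> is obtained as the limit along this
  subspace.
\<close>

definition bounded_operator :: "L2 \<Rightarrow> (L2 \<Rightarrow> L2) \<Rightarrow> bool" where
  "bounded_operator u T \<longleftrightarrow> (\<exists>C. \<forall>f\<in>bounded_model_space u. norm (T f) \<le> C * norm f)"

definition extend_operator :: "L2 \<Rightarrow> (L2 \<Rightarrow> L2) \<Rightarrow> L2 \<Rightarrow> L2" where
  "extend_operator u T f = Lim (inf (nhds f) (principal (bounded_model_space u))) T"

definition toeplitz_pre :: "L2 \<Rightarrow> L2 \<Rightarrow> L2 \<Rightarrow> L2 \<Rightarrow> L2" where
  "toeplitz_pre u v \<phi> f = orth_proj (model_space v) (\<phi> \<cdot> f)"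

definition hankel_pre :: "L2 \<Rightarrow> L2 \<Rightarrow> L2 \<Rightarrow> L2 \<Rightarrow> L2" where
  "hankel_pre u v \<phi> f =
    orth_proj (model_space v) (flip (\<phi> \<cdot> f - orth_proj H2 (\<phi> \<cdot> f)))"

definition toeplitz_op :: "L2 \<Rightarrow> L2 \<Rightarrow> L2 \<Rightarrow> L2 \<Rightarrow> L2" where
  "toeplitz_op u v \<phi> = extend_operator u (toeplitz_pre u v \<phi>)"

definition hankel_op :: "L2 \<Rightarrow> L2 \<Rightarrow> L2 \<Rightarrow> L2 \<Rightarrow> L2" where
  "hankel_op u v \<phi> = extend_operator u (hankel_pre u v \<phi>)"

text \<open>
  Operators from \<open>model_space u\<close> to \<open>model_space v\<close> are represented by functions on the whole
  space \<open>L2\<close>, of which only the restriction to \<open>model_space u\<close> is relevant.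
\<close>

definition toeplitz_space :: "L2 \<Rightarrow> L2 \<Rightarrow> (L2 \<Rightarrow> L2) set" where
  "toeplitz_space u v = {T. \<exists>\<phi>. bounded_operator u (toeplitz_pre u v \<phi>) \<and>
    (\<forall>f\<in>model_space u. T f = toeplitz_op u v \<phi> f)}"

definition hankel_space :: "L2 \<Rightarrow> L2 \<Rightarrow> (L2 \<Rightarrow> L2) set" where
  "hankel_space u v = {T. \<exists>\<phi>. bounded_operator u (hankel_pre u v \<phi>) \<and>
    (\<forall>f\<in>model_space u. T f = hankel_op u v \<phi> f)}"

end

(* Pointwise conjugation symmetries reduce everything to one operator product.  Let
   C_u f = u zbar cnj(f), the conjugation of K_u, let f^ denote the hat of f, and let J be the flip.
   Since J maps the orthogonal complement of H^2 onto H^2, B^{u,v}_phi f = P_v J (phi f), and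
     A^{u,v^}_{cnj(u phi)}  = hat B^{u,v}_phi C_u,     A^{u^,v}_{v phi^}    = C_v B^{u,v}_phi hat,
     B^{u,v}_{cnj(u v^ phi)} = C_v B^{u,v}_phi C_u,     B^{u^,v^}_{phi^}     = hat B^{u,v}_phi hat.
   With T = B^{v,w}_{phi_1} B^{u,v}_{phi_2}, the products in (2), (3), (4) are therefore C_w T C_u,
   hat T hat and hat T C_u, and the same identities show that these transformations of T carry
   H(u,w) onto H(u,w), H(u^,w^) and T(u,w^).  The limits and projections in the definitions exist
   because L^2 is complete, H^2 consists of the functions without negative Fourier coefficients,
   and P_u z^k is bounded, so that bounded functions are dense in K_u. *)
theory Submission
  imports Defs "HOL-Complex_Analysis.Complex_Analysis"
begin

section \<open>Integration on the circle\<close>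

text \<open>\<open>orth_proj\<close> is a \<open>THE\<close>, \<open>extend_operator\<close> is a
  \<open>Lim\<close>, and \<open>H2\<close> consists of mean-square limits of dilates, so each of
  these notions calls for an existence argument before it can be used. Questions about
  \<open>H2\<close> are therefore turned into questions about Fourier coefficients, which
  \<open>L2_hat\<close> and \<open>L2_conj\<close> merely conjugate and reindex. A second obstacle
  is that a product with a symbol may be the default value 0. The symmetries are antiunitary and
  multiply only by unimodular functions, so they never change whether a product is square
  integrable: the identities between the operators before extension hold for every argument, and
  boundedness passes across with the same constant. In the products the symmetries in the middle
  meet and cancel, hat against hat in (2) and \<open>C_v\<close> against \<open>C_v\<close> in (3)
  and (4); the symbols are twisted so that this happens.\<close>

lemma circle_measurable_id: "(\<lambda>z. z) \<in> borel_measurable circle"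
  unfolding measurable_cong_sets[OF sets_circle refl] by (rule measurable_restrict_space1) simp

lemma borel_measurable_circle_continuous:
  assumes "continuous_on (sphere 0 1) g"
  shows "g \<in> borel_measurable circle"
  unfolding measurable_cong_sets[OF sets_circle refl]
  using borel_measurable_continuous_on_restrict[OF assms] .

lemma integral_circle:
  fixes g :: "complex \<Rightarrow> complex"
  assumes "g \<in> borel_measurable circle"
  shows "(\<integral>z. g z \<partial>circle) = (LINT t|lborel. indicator {0..2*pi} t *\<^sub>R g (cis t)) /\<^sub>R (2*pi)"
proof -
  have g: "g \<in> borel_measurable (restrict_space borel (sphere 0 1))"
    using assms unfolding measurable_cong_sets[OF sets_circle refl] .
  have m: "(\<lambda>t. g (cis t)) \<in> borel_measurable borel"
    using measurable_compose[OF cis_measurable g] by (simp add: measurable_def)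
  have "(\<integral>z. g z \<partial>circle) = (\<integral>t. g (cis t) \<partial>uniform_measure lborel {0..2*pi})"
    unfolding circle_def by (rule integral_distr[OF cis_measurable g])
  also have "uniform_measure lborel {0..2*pi} =
      density lborel (\<lambda>t. ennreal (indicator {0..2*pi} t / (2*pi)))"
    unfolding uniform_measure_def
    by (intro density_cong) (auto simp: indicator_def divide_ennreal[symmetric] simp del: ennreal_1 simp flip: ennreal_1)
  also have "(\<integral>t. g (cis t) \<partial>\<dots>) = (LINT t|lborel. (indicator {0..2*pi} t / (2*pi)) *\<^sub>R g (cis t))"
    using m by (intro integral_density) auto
  also have "\<dots> = (LINT t|lborel. inverse (2*pi) *\<^sub>R (indicator {0..2*pi} t *\<^sub>R g (cis t)))"
    by (intro Bochner_Integration.integral_cong) (auto simp: field_simps)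
  also have "\<dots> = (LINT t|lborel. indicator {0..2*pi} t *\<^sub>R g (cis t)) /\<^sub>R (2*pi)"
    by (rule integral_scaleR_right)
  finally show ?thesis .
qed

lemma continuous_on_circle_powi: "continuous_on (sphere 0 1) (\<lambda>z::complex. z powi n)"
  by (intro continuous_intros) auto

lemma circle_powi_measurable: "(\<lambda>z. z powi n) \<in> borel_measurable circle"
  by (intro borel_measurable_circle_continuous continuous_on_circle_powi)

lemma integral_circle_powi: "(\<integral>z. z powi n \<partial>circle) = (if n = 0 then 1 else 0)"
proof (cases "n = 0")
  case True
  have "(LINT t|lborel. indicator {0..2*pi} t *\<^sub>R (1::complex)) = of_real (2*pi)"
    using has_bochner_integral_FTC_Icc[of 0 "2*pi" "\<lambda>t. complex_of_real t" "\<lambda>_. 1"]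
    by (auto simp: has_vector_derivative_def has_bochner_integral_iff
      intro!: derivative_eq_intros) (simp add: scaleR_conv_of_real)
  then have "(\<integral>z. 1 \<partial>circle) = (1::complex)"
    by (subst integral_circle) (simp_all add: scaleR_conv_of_real)
  with True show ?thesis by simp
next
  case False
  \<comment> \<open>For \<open>n\<close> nonzero this primitive has period 2 pi, so its values at
    both ends agree.\<close>
  let ?F = "\<lambda>t. cis (of_int n * t) / (\<i> * of_int n)"
  have "has_bochner_integral lborel (\<lambda>t. indicator {0..2*pi} t *\<^sub>R cis (of_int n * t)) (?F (2*pi) - ?F 0)"
  proof (rule has_bochner_integral_FTC_Icc)
    fix t
    show "(?F has_vector_derivative cis (of_int n * t)) (at t within {0..2*pi})"
      using False by (auto intro!: derivative_eq_intros simp: has_vector_derivative_def scaleR_conv_of_real field_simps)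
  qed (auto intro!: continuous_intros)
  moreover have "cis (of_int n * (2*pi)) = 1"
    using cis_multiple_2pi[of "of_int n"] by (simp add: mult_ac)
  ultimately have "(LINT t|lborel. indicator {0..2*pi} t *\<^sub>R cis (of_int n * t)) = 0"
    by (simp add: has_bochner_integral_iff)
  moreover have "cis t powi n = cis (of_int n * t)" for t
    by (simp add: cis_power_int)
  ultimately show ?thesis using False
    by (simp add: integral_circle[OF circle_powi_measurable])
qed

lemma measure_circle: "measure circle (space circle) = 1"
  using integral_circle_powi[of 0] by (simp add: complex_eq_iff)

lemma square_integrable_bounded:
  assumes "f \<in> borel_measurable circle" "\<And>z. z \<in> sphere 0 1 \<Longrightarrow> cmod (f z) \<le> K"
  shows "f \<in> square_integrable"
proof -
  have "integrable circle (\<lambda>z. (cmod (f z))\<^sup>2)"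
  proof (rule circle.integrable_const_bound)
    show "AE z in circle. norm ((cmod (f z))\<^sup>2) \<le> K\<^sup>2"
      using assms(2) by (intro AE_I2) (auto simp: space_circle intro!: power_mono)
  qed (use assms in measurable)
  with assms show ?thesis by (simp add: square_integrable_def)
qed

lemma square_integrable_integrable:
  assumes "f \<in> square_integrable"
  shows "integrable circle f"
  using square_integrable_prod[OF assms square_integrable_const[of 1]] by simp

section \<open>Uniqueness of Fourier coefficients\<close>

lemma integrable_circle_mult:
  assumes "integrable circle f" "continuous_on (sphere 0 1) g"
  shows "integrable circle (\<lambda>z. f z * g z :: complex)"
proof -
  have "bounded (g ` sphere 0 1)"
    by (intro compact_imp_bounded compact_continuous_image assms) auto
  then obtain K where "\<forall>y\<in>g ` sphere 0 1. norm y \<le> K"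
    unfolding bounded_iff by blast
  then have K: "\<And>z. z \<in> sphere 0 1 \<Longrightarrow> cmod (g z) \<le> K"
    by blast
  show ?thesis
  proof (rule Bochner_Integration.integrable_bound)
    show "integrable circle (\<lambda>z. of_real K * f z)"
      using assms by simp
    show "(\<lambda>z. f z * g z) \<in> borel_measurable circle"
      using assms borel_measurable_circle_continuous by (intro borel_measurable_times) auto
    show "AE z in circle. norm (f z * g z) \<le> norm (of_real K * f z)"
    proof (rule AE_I2)
      fix z assume "z \<in> space circle"
      then have "cmod (g z) \<le> \<bar>K\<bar>" using K[of z] by (simp add: space_circle)
      then show "norm (f z * g z) \<le> norm (of_real K * f z)"
        unfolding norm_mult norm_of_real by (metis mult.commute mult_right_mono norm_ge_zero)
    qed
  qed
qed

lemma continuous_on_real_polynomial_function: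
  "real_polynomial_function p \<Longrightarrow> continuous_on S p"
  by (simp add: continuous_at_imp_continuous_on continuous_real_polymonial_function)

text \<open>The weight \<open>g\<close> and the exponent \<open>m\<close> are kept general for the
  induction: a product \<open>p * q\<close> is handled by absorbing \<open>p\<close> into the weight
  before the hypothesis for \<open>q\<close> is applied, and a linear factor changes
  \<open>m\<close>.\<close>

lemma integral_real_polynomial_eq_0:
  assumes f: "integrable circle f" and "real_polynomial_function p"
    and "continuous_on (sphere 0 1) g" "\<And>m. (\<integral>z. f z * g z * z powi m \<partial>circle) = 0"
  shows "(\<integral>z. f z * (g z * of_real (p z)) * z powi m \<partial>circle) = 0"
  using assms(2-)
proof (induction arbitrary: g m rule: real_polynomial_function.induct)
  case (linear L)
  interpret L: bounded_linear L by fact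
  \<comment> \<open>\<open>c\<close> and \<open>d\<close> come from writing \<open>Re z\<close> and
    \<open>Im z\<close> through \<open>z\<close> and \<open>cnj z\<close>. On the circle
    \<open>cnj z\<close> is the inverse of \<open>z\<close>, so multiplication by \<open>L\<close>
    only shifts the exponent by one in either direction.\<close>
  define a b c d where "a = L 1" and "b = L \<i>"
    and "c = (complex_of_real a - \<i> * of_real b) / 2" and "d = (complex_of_real a + \<i> * of_real b) / 2"
  have L: "L z = a * Re z + b * Im z" for z
  proof -
    have "z = Re z *\<^sub>R 1 + Im z *\<^sub>R \<i>" by (simp add: complex_eq_iff)
    then have "L z = L (Re z *\<^sub>R 1 + Im z *\<^sub>R \<i>)" by (rule arg_cong)
    then show ?thesis by (simp add: L.add L.scaleR a_def b_def)
  qed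
  have eq: "f z * (g z * of_real (L z)) * z powi m =
      c * (f z * g z * z powi (m + 1)) + d * (f z * g z * z powi (m - 1))"
    if "z \<in> sphere 0 1" for z
  proof -
    from that have z: "z \<noteq> 0" "inverse z = cnj z"
      using inverse_unique[of z "cnj z"] complex_norm_square[of z] by auto
    have "z powi (m - 1) = z powi m * cnj z" "z powi (m + 1) = z powi m * z"
      using z by (simp_all add: power_int_diff power_int_add divide_inverse)
    moreover have "of_real (L z) = c * z + d * cnj z"
      by (simp add: L c_def d_def complex_eq_iff field_simps)
    ultimately show ?thesis by (simp add: algebra_simps)
  qed
  have i: "integrable circle (\<lambda>z. f z * g z * z powi k)" for k
    by (intro integrable_circle_mult f linear continuous_on_circle_powi)
  have "(\<integral>z. f z * (g z * of_real (L z)) * z powi m \<partial>circle) =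
      (\<integral>z. c * (f z * g z * z powi (m + 1)) + d * (f z * g z * z powi (m - 1)) \<partial>circle)"
    by (intro Bochner_Integration.integral_cong refl eq) (simp add: space_circle)
  then show ?case using i by (simp add: linear)
next
  case (const c)
  have "(\<integral>z. f z * (g z * of_real c) * z powi m \<partial>circle) = (\<integral>z. of_real c * (f z * g z * z powi m) \<partial>circle)"
    by (simp add: mult_ac)
  then show ?case using const by simp
next
  case (add p q)
  have i: "integrable circle (\<lambda>z. f z * (g z * of_real (h z)) * z powi m)"
    if "real_polynomial_function h" for h
    by (intro integrable_circle_mult f add continuous_intros continuous_on_circle_powi
        continuous_on_real_polynomial_function that)
  have "(\<integral>z. f z * (g z * of_real (p z + q z)) * z powi m \<partial>circle) =
      (\<integral>z. f z * (g z * of_real (p z)) * z powi m + f z * (g z * of_real (q z)) * z powi m \<partial>circle)"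
    by (simp add: algebra_simps)
  then show ?case using i add by simp
next
  case (mult p q)
  have "(\<integral>z. f z * ((g z * of_real (p z)) * of_real (q z)) * z powi m \<partial>circle) = 0"
    by (intro mult continuous_intros continuous_on_real_polynomial_function)
  then show ?case by (simp add: mult_ac)
qed

text \<open>By Stone-Weierstrass \<open>h\<close> is within \<open>e\<close> of a polynomial, whose
  integral against \<open>f\<close> vanishes. The error is at most \<open>e\<close> times the
  integral of \<open>cmod (f z)\<close>, and \<open>e\<close> is arbitrary.\<close>

lemma integral_continuous_eq_0:
  assumes f: "integrable circle f" and z: "\<And>m. (\<integral>z. f z * z powi m \<partial>circle) = 0"
    and h: "continuous_on (sphere 0 1) h"
  shows "(\<integral>z. f z * of_real (h z) \<partial>circle) = 0"
proof -
  define N where "N = (\<integral>z. cmod (f z) \<partial>circle)"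
  have le: "cmod (\<integral>z. f z * of_real (h z) \<partial>circle) \<le> e * N" if "e > 0" for e
  proof -
    obtain p where p: "real_polynomial_function p" "\<And>z. z \<in> sphere 0 1 \<Longrightarrow> \<bar>h z - p z\<bar> < e"
      using Stone_Weierstrass_real_polynomial_function[OF _ h \<open>e > 0\<close>] by (auto simp: compact_sphere)
    have pc: "continuous_on (sphere 0 1) p"
      using p(1) by (rule continuous_on_real_polynomial_function)
    have "(\<integral>z. f z * of_real (p z) \<partial>circle) = 0"
      using integral_real_polynomial_eq_0[OF f p(1), of "\<lambda>_. 1" 0] z by simp
    moreover have ih: "integrable circle (\<lambda>z. f z * of_real (h z))"
      and ip: "integrable circle (\<lambda>z. f z * of_real (p z))"
      by (intro integrable_circle_mult f continuous_intros h pc)+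
    ultimately have "(\<integral>z. f z * of_real (h z) \<partial>circle) = (\<integral>z. f z * of_real (h z) - f z * of_real (p z) \<partial>circle)"
      by simp
    also have "cmod \<dots> \<le> (\<integral>z. e * cmod (f z) \<partial>circle)"
    proof (rule Bochner_Integration.integral_norm_bound_integral)
      fix z assume "z \<in> space circle"
      then have "\<bar>h z - p z\<bar> \<le> e" using p(2)[of z] by (simp add: space_circle)
      moreover have "f z * of_real (h z) - f z * of_real (p z) = f z * of_real (h z - p z)"
        by (simp add: algebra_simps)
      ultimately show "cmod (f z * of_real (h z) - f z * of_real (p z)) \<le> e * cmod (f z)"
        by (simp add: norm_mult mult.commute[of "cmod (f z)"] mult_right_mono del: of_real_diff)
    qed (use ih ip f in auto)
    finally show ?thesis by (simp add: N_def)
  qed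
  have "((\<lambda>e. e * N) \<longlongrightarrow> 0 * N) (at_right 0)" by (intro tendsto_intros)
  then have "cmod (\<integral>z. f z * of_real (h z) \<partial>circle) \<le> 0 * N"
    by (rule tendsto_lowerbound) (auto simp: eventually_at_filter le)
  then show ?thesis by simp
qed

lemma integral_closed_eq_0:
  assumes f: "integrable circle f" and z: "\<And>m. (\<integral>z. f z * z powi m \<partial>circle) = 0"
    and A: "closed A"
  shows "(\<integral>z. f z * indicator A z \<partial>circle) = 0"
proof (cases "A = {}")
  case False
  \<comment> \<open>These continuous functions decrease to the indicator of \<open>A\<close>, since
    a closed set is the zero set of its distance function. The empty set is treated apart because
    \<open>infdist\<close> to it is 0 by convention, which would make every \<open>h n\<close> equal
    to 1.\<close>
  define h where "h n z = max 0 (1 - real n * infdist z A)" for n z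
  have c: "continuous_on (sphere 0 1) (h n)" for n
    unfolding h_def by (intro continuous_intros)
  have "(\<lambda>n. \<integral>z. f z * of_real (h n z) \<partial>circle) \<longlonglongrightarrow> (\<integral>z. f z * indicator A z \<partial>circle)"
  proof (rule integral_dominated_convergence)
    show "integrable circle (\<lambda>z. cmod (f z))" using f by simp
    have "A \<in> sets borel" using A by simp
    then have "(indicator A :: complex \<Rightarrow> complex) \<in> borel_measurable circle"
      unfolding measurable_cong_sets[OF sets_circle refl]
      by (intro measurable_restrict_space1 borel_measurable_indicator)
    then show "(\<lambda>z. f z * indicator A z) \<in> borel_measurable circle"
      using f by (intro borel_measurable_times) auto
    show "(\<lambda>z. f z * of_real (h n z)) \<in> borel_measurable circle" for n
      by (intro borel_measurable_integrable integrable_circle_mult f continuous_intros c)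
    have "(\<lambda>n. h n z) \<longlonglongrightarrow> indicator A z" for z
    proof (cases "z \<in> A")
      case True
      then show ?thesis by (simp add: h_def)
    next
      case False
      then have "infdist z A > 0"
        using in_closed_iff_infdist_zero[OF A \<open>A \<noteq> {}\<close>] infdist_nonneg[of z A] by (simp add: order_less_le)
      then have "eventually (\<lambda>n. real n \<ge> 1 / infdist z A) sequentially"
        using filterlim_real_sequentially eventually_compose_filterlim eventually_ge_at_top by blast
      then have "eventually (\<lambda>n. h n z = indicator A z) sequentially"
        by eventually_elim (use False \<open>infdist z A > 0\<close> in \<open>auto simp: h_def field_simps\<close>)
      then show ?thesis by (rule tendsto_eventually)
    qed
    then have "(\<lambda>n. complex_of_real (h n z)) \<longlonglongrightarrow> of_real (indicator A z)" for z
      by (intro tendsto_of_real)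
    then have "(\<lambda>n. f z * of_real (h n z)) \<longlonglongrightarrow> f z * of_real (indicator A z)" for z
      by (intro tendsto_mult_left)
    moreover have "of_real (indicator A z) = (indicator A z :: complex)" for z :: complex
      by (simp add: indicator_def)
    ultimately show "AE z in circle. (\<lambda>n. f z * of_real (h n z)) \<longlonglongrightarrow> f z * indicator A z"
      by simp
    have "\<bar>h n z\<bar> \<le> 1" for n z
      using infdist_nonneg[of z A] by (auto simp: h_def)
    then show "AE z in circle. norm (f z * of_real (h n z)) \<le> cmod (f z)" for n
      by (auto simp: norm_mult mult_left_le)
  qed
  moreover have "(\<integral>z. f z * of_real (h n z) \<partial>circle) = 0" for n
    by (rule integral_continuous_eq_0[OF f z c])
  ultimately show ?thesis by (simp add: LIMSEQ_const_iff)
qed simp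

text \<open>A pi-lambda argument: closed sets are stable under intersection and generate the Borel
  sets. Complements use that \<open>f\<close> itself has integral 0, the case \<open>m = 0\<close>;
  disjoint unions use countable additivity.\<close>

lemma integral_borel_eq_0:
  assumes f: "integrable circle f" and z: "\<And>m. (\<integral>z. f z * z powi m \<partial>circle) = 0"
    and A: "A \<in> sets borel"
  shows "(\<integral>z. f z * indicator A z \<partial>circle) = 0"
proof -
  have i: "integrable circle (\<lambda>z. f z * indicator B z)" if "B \<in> sets borel" for B
  proof (rule Bochner_Integration.integrable_bound[OF f])
    have "(indicator B :: complex \<Rightarrow> complex) \<in> borel_measurable circle"
      unfolding measurable_cong_sets[OF sets_circle refl] using that
      by (intro measurable_restrict_space1 borel_measurable_indicator)
    then show "(\<lambda>z. f z * indicator B z) \<in> borel_measurable circle"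
      using f by (intro borel_measurable_times) auto
  qed (auto simp: indicator_def)
  have i0: "(\<integral>z. f z \<partial>circle) = 0" using z[of 0] by simp
  have b: "sets borel = sigma_sets UNIV (Collect (closed :: complex set \<Rightarrow> bool))"
    by (subst borel_eq_closed) simp
  show ?thesis
  proof (rule sigma_sets_induct_disjoint[where G = "Collect closed" and \<Omega> = UNIV and A = A])
    show "Int_stable (Collect (closed :: complex set \<Rightarrow> bool))" by (auto simp: Int_stable_def)
    show "A \<in> sigma_sets UNIV (Collect closed)" using A unfolding b .
    show "(\<integral>z. f z * indicator A z \<partial>circle) = 0" if "A \<in> Collect closed" for A
      using that by (intro integral_closed_eq_0 f z) simp
    fix A assume A: "A \<in> sigma_sets UNIV (Collect closed)" "(\<integral>z. f z * indicator A z \<partial>circle) = 0"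
    have Ab: "A \<in> sets borel" using A(1) unfolding b .
    have "(\<integral>z. f z * indicator (UNIV - A) z \<partial>circle) = (\<integral>z. f z - f z * indicator A z \<partial>circle)"
      by (intro Bochner_Integration.integral_cong) (auto simp: indicator_def)
    also have "\<dots> = (\<integral>z. f z \<partial>circle) - (\<integral>z. f z * indicator A z \<partial>circle)"
      by (intro Bochner_Integration.integral_diff f i Ab)
    finally show "(\<integral>z. f z * indicator (UNIV - A) z \<partial>circle) = 0" using A i0 by simp
  next
    fix A :: "nat \<Rightarrow> complex set"
    assume A: "disjoint_family A" "range A \<subseteq> sigma_sets UNIV (Collect closed)"
      "\<And>i. (\<integral>z. f z * indicator (A i) z \<partial>circle) = 0"
    \<comment> \<open>The induction runs over sets of the plane, while set integrals require
      measurable subsets of \<open>circle\<close>. Intersecting with the sphere leaves every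
      integrand on the circle unchanged.\<close>
    define B where "B = (\<lambda>i. A i \<inter> sphere 0 1)"
    have AB: "A i \<in> sets borel" for i using A(2) unfolding b by blast
    then have sB: "B i \<in> sets circle" for i
      by (auto simp: B_def sets_circle sets_restrict_space)
    have c: "indicator (B i) z *\<^sub>R f z = f z * indicator (A i) z" if "z \<in> space circle" for i z
      using that by (auto simp: B_def indicator_def space_circle)
    have c': "indicator (\<Union>i. B i) z *\<^sub>R f z = f z * indicator (\<Union>i. A i) z" if "z \<in> space circle" for z
      using that by (auto simp: B_def indicator_def space_circle)
    have "integrable circle (\<lambda>z. f z * indicator (\<Union>i. A i) z)"
      using AB by (intro i) auto
    then have "set_integrable circle (\<Union>i. B i) f"
      unfolding set_integrable_def
      by (subst Bochner_Integration.integrable_cong[OF refl c']) auto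
    then have "(LINT z:(\<Union>i. B i)|circle. f z) = (\<Sum>i. (LINT z:(B i)|circle. f z))"
      using A(1) sB by (intro lebesgue_integral_countable_add) (auto simp: disjoint_family_on_def B_def)
    moreover have "(LINT z:(B i)|circle. f z) = 0" for i
      unfolding set_lebesgue_integral_def
      by (subst Bochner_Integration.integral_cong[OF refl c]) (auto simp: A)
    moreover have "(LINT z:(\<Union>i. B i)|circle. f z) = (\<integral>z. f z * indicator (\<Union>i. A i) z \<partial>circle)"
      unfolding set_lebesgue_integral_def
      by (intro Bochner_Integration.integral_cong refl c') auto
    ultimately show "(\<integral>z. f z * indicator (\<Union>(range A)) z \<partial>circle) = 0" by simp
  qed auto
qed

text \<open>Testing with the set where \<open>Re (f z) > 0\<close> shows that the positive part of
  \<open>Re (f z)\<close> has integral 0, so it vanishes almost everywhere.\<close>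

lemma AE_Re_le_0:
  assumes f: "integrable circle f"
    and A: "\<And>A. A \<in> sets borel \<Longrightarrow> (\<integral>z. f z * indicator A z \<partial>circle) = 0"
  shows "AE z in circle. Re (f z) \<le> 0"
proof -
  have "{z \<in> space circle. Re (f z) > 0} \<in> sets circle"
    using borel_measurable_integrable[OF f] by measurable
  then obtain A where A': "A \<in> sets borel" "{z \<in> space circle. Re (f z) > 0} = sphere 0 1 \<inter> A"
    by (auto simp: sets_circle sets_restrict_space)
  have "Re (f z) > 0 \<longleftrightarrow> z \<in> A" if "z \<in> space circle" for z
    using that A'(2) unfolding space_circle by blast
  then have c: "max 0 (Re (f z)) = Re (f z * indicator A z)" if "z \<in> space circle" for z
    using that by (cases "z \<in> A") (force simp: max_def)+
  have "(indicator A :: complex \<Rightarrow> complex) \<in> borel_measurable circle"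
    unfolding measurable_cong_sets[OF sets_circle refl] using A'
    by (intro measurable_restrict_space1 borel_measurable_indicator)
  then have "(\<lambda>z. f z * indicator A z) \<in> borel_measurable circle"
    by (intro borel_measurable_times borel_measurable_integrable[OF f])
  then have iA: "integrable circle (\<lambda>z. f z * indicator A z)"
    by (rule Bochner_Integration.integrable_bound[OF f]) (simp add: indicator_def)
  have "(\<integral>z. max 0 (Re (f z)) \<partial>circle) = (\<integral>z. Re (f z * indicator A z) \<partial>circle)"
    by (intro Bochner_Integration.integral_cong refl c)
  also have "\<dots> = 0" using A[OF A'(1)] integral_Re[OF iA] by simp
  finally have "(\<integral>z. max 0 (Re (f z)) \<partial>circle) = 0" .
  moreover have "integrable circle (\<lambda>z. max 0 (Re (f z)))"
    using f by (intro integrable_max) auto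
  ultimately have "AE z in circle. max 0 (Re (f z)) = 0"
    by (subst (asm) integral_nonneg_eq_0_iff_AE) simp_all
  then show ?thesis by eventually_elim (auto simp: max_def split: if_splits)
qed

lemma fourier_coefficients_unique:
  assumes f: "integrable circle f" and z: "\<And>m. (\<integral>z. f z * z powi m \<partial>circle) = 0"
  shows "AE z in circle. f z = 0"
proof -
  have *: "AE z in circle. Re (c * f z) \<le> 0" for c
  proof (rule AE_Re_le_0)
    show "integrable circle (\<lambda>z. c * f z)" using f by simp
    show "(\<integral>z. c * f z * indicator A z \<partial>circle) = 0" if "A \<in> sets borel" for A
      using integral_borel_eq_0[OF f z that] by (simp add: mult.assoc)
  qed
  \<comment> \<open>The four rotations bound \<open>Re (f z)\<close> and \<open>Im (f z)\<close>
    from both sides by 0.\<close>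
  from *[of 1] *[of "-1"] *[of \<i>] *[of "-\<i>"] show ?thesis
    by eventually_elim (auto simp: complex_eq_iff)
qed

section \<open>Completeness of L2\<close>

lemma L2_cases [cases type: L2]:
  obtains f where "f \<in> square_integrable" "x = abs_L2 f"
proof
  show "rep_L2 x \<in> square_integrable"
    using Quotient3_rep_reflp[OF Quotient3_L2] by (rule AE_equal_D)
  show "x = abs_L2 (rep_L2 x)"
    by (simp add: Quotient3_abs_rep[OF Quotient3_L2])
qed

lemma AE_equal_refl: "AE_equal f f \<longleftrightarrow> f \<in> square_integrable"
  by (simp add: AE_equal_def)

lemma abs_L2_eqI:
  assumes "f \<in> square_integrable" "g \<in> square_integrable" "AE z in circle. f z = g z"
  shows "abs_L2 f = abs_L2 g"
  using assms by (intro Quotient3_rel_abs[OF Quotient3_L2]) (simp add: AE_equal_def)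

lemma norm_abs_L2:
  assumes "f \<in> square_integrable"
  shows "(norm (abs_L2 f))\<^sup>2 = (\<integral>z. (cmod (f z))\<^sup>2 \<partial>circle)"
proof -
  have "(norm (abs_L2 f))\<^sup>2 = Re (\<integral>z. f z * cnj (f z) \<partial>circle)"
    using assms inner_ge_zero[of "abs_L2 f"]
    by (simp add: norm_L2_def inner_L2_def cinner.abs_eq AE_equal_refl)
  also have "(\<integral>z. f z * cnj (f z) \<partial>circle) = (\<integral>z. complex_of_real ((cmod (f z))\<^sup>2) \<partial>circle)"
    by (intro Bochner_Integration.integral_cong) (auto simp: complex_mult_cnj cmod_power2)
  finally show ?thesis by (simp only: integral_complex_of_real Re_complex_of_real)
qed

lemma square_integrable_diff:
  assumes "f \<in> square_integrable" "g \<in> square_integrable"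
  shows "(\<lambda>z. f z - g z) \<in> square_integrable"
  using square_integrable_add[OF assms(1) square_integrable_scale[OF assms(2), of "-1"]] by simp

lemma abs_L2_diff:
  assumes "f \<in> square_integrable" "g \<in> square_integrable"
  shows "abs_L2 f - abs_L2 g = abs_L2 (\<lambda>z. f z - g z)"
  using assms by (simp add: minus_L2.abs_eq AE_equal_refl)

text \<open>The core of the Riesz-Fischer argument: the rate \<open>(1/2) ^ n\<close> makes the
  integrals of the successive distances summable, so the series of differences converges absolutely
  at almost every point.\<close>

lemma AE_convergent_fast_Cauchy:
  fixes x :: "nat \<Rightarrow> complex \<Rightarrow> complex"
  assumes x: "\<And>n. x n \<in> square_integrable"
    and le: "\<And>n. (\<integral>z. (cmod (x (Suc n) z - x n z))\<^sup>2 \<partial>circle) \<le> ((1/2) ^ n)\<^sup>2"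
  shows "AE z in circle. convergent (\<lambda>n. x n z)"
proof -
  define d where "d n z = cmod (x (Suc n) z - x n z)" for n z
  have si: "(\<lambda>z. x (Suc n) z - x n z) \<in> square_integrable" for n
    by (intro square_integrable_diff x)
  have d: "integrable circle (d n)" for n
    unfolding d_def by (intro integrable_norm square_integrable_integrable si)
  have d2: "integrable circle (\<lambda>z. (d n z)\<^sup>2)" for n
    using si[of n] by (simp add: d_def square_integrable_def)
  have int_d: "(\<integral>z. d n z \<partial>circle) \<le> (1/2) ^ n" for n
  proof -
    define c :: real where "c = (1/2) ^ n"
    have c: "c > 0" by (simp add: c_def)
    \<comment> \<open>The weighted inequality between arithmetic and geometric mean takes the place
      of Cauchy-Schwarz. With weight \<open>c\<close> both summands integrate to at most
      \<open>c\<close>, as the circle has total mass 1.\<close>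
    have "(\<integral>z. d n z \<partial>circle) \<le> (\<integral>z. (c + (d n z)\<^sup>2 / c) / 2 \<partial>circle)"
    proof (rule integral_mono)
      fix z
      have "0 \<le> (c - d n z)\<^sup>2 / c" using c by simp
      also have "\<dots> = c + (d n z)\<^sup>2 / c - 2 * d n z"
        using c by (simp add: power2_eq_square field_simps)
      finally show "d n z \<le> (c + (d n z)\<^sup>2 / c) / 2" by simp
    qed (use d d2 in auto)
    also have "\<dots> = (c + (\<integral>z. (d n z)\<^sup>2 \<partial>circle) / c) / 2"
      using d2 measure_circle by simp
    also have "\<dots> \<le> (c + c\<^sup>2 / c) / 2"
      using le[of n] c by (intro divide_right_mono add_left_mono) (auto simp: d_def c_def)
    also have "\<dots> = c" using c by (simp add: power2_eq_square)
    finally show ?thesis by (simp add: c_def)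
  qed
  have dm [measurable]: "d n \<in> borel_measurable circle" for n
    using d by (rule borel_measurable_integrable)
  have "(\<integral>\<^sup>+z. (\<Sum>n. ennreal (d n z)) \<partial>circle) = (\<Sum>n. \<integral>\<^sup>+z. ennreal (d n z) \<partial>circle)"
    by (rule nn_integral_suminf) measurable
  also have "\<dots> \<le> (\<Sum>n. ennreal ((1/2) ^ n))"
  proof (intro suminf_le allI)
    fix n
    have "(\<integral>\<^sup>+z. ennreal (d n z) \<partial>circle) = ennreal (\<integral>z. d n z \<partial>circle)"
      by (intro nn_integral_eq_integral d AE_I2) (simp add: d_def)
    then show "(\<integral>\<^sup>+z. ennreal (d n z) \<partial>circle) \<le> ennreal ((1/2) ^ n)"
      using int_d by (simp add: ennreal_leI)
  qed auto
  also have "\<dots> = ennreal (\<Sum>n. (1/2) ^ n)"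
    by (intro suminf_ennreal2 summable_geometric) auto
  finally have "(\<integral>\<^sup>+z. (\<Sum>n. ennreal (d n z)) \<partial>circle) \<noteq> \<infinity>"
    by (auto simp: top_unique)
  then have "AE z in circle. (\<Sum>n. ennreal (d n z)) \<noteq> \<infinity>"
    by (intro nn_integral_noteq_infinite) measurable
  then show ?thesis
  proof eventually_elim
    case (elim z)
    then have "summable (\<lambda>n. d n z)"
      by (intro summable_suminf_not_top) (auto simp: d_def)
    then have "summable (\<lambda>n. x (Suc n) z - x n z)"
      unfolding d_def by (rule summable_norm_cancel)
    then have "(\<lambda>n. \<Sum>i<n. x (Suc i) z - x i z) \<longlonglongrightarrow> (\<Sum>i. x (Suc i) z - x i z)"
      by (rule summable_LIMSEQ)
    then have "(\<lambda>n. (x n z - x 0 z) + x 0 z) \<longlonglongrightarrow> (\<Sum>i. x (Suc i) z - x i z) + x 0 z"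
      unfolding sum_lessThan_telescope[of "\<lambda>n. x n z"] by (intro tendsto_intros)
    then show ?case by (simp add: convergent_def) blast
  qed
qed

text \<open>Fatou's lemma for \<open>m\<close> tending to infinity with \<open>n\<close> fixed: the
  pointwise limit inherits the bounds on the distances. The limit is square integrable because its
  difference from \<open>x 0\<close> is.\<close>

lemma L2_limit_fast_Cauchy:
  fixes x :: "nat \<Rightarrow> complex \<Rightarrow> complex"
  assumes x: "\<And>n. x n \<in> square_integrable"
    and conv: "AE z in circle. convergent (\<lambda>n. x n z)"
    and le: "\<And>m n. n \<le> m \<Longrightarrow> (\<integral>z. (cmod (x m z - x n z))\<^sup>2 \<partial>circle) \<le> (2 * (1/2) ^ n)\<^sup>2"
  shows "\<exists>y\<in>square_integrable. \<forall>n. (\<integral>z. (cmod (y z - x n z))\<^sup>2 \<partial>circle) \<le> (2 * (1/2) ^ n)\<^sup>2"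
proof -
  define y where "y z = lim (\<lambda>n. x n z)" for z
  have xm [measurable]: "x n \<in> borel_measurable circle" for n
    using x by (simp add: square_integrable_def)
  have ym [measurable]: "y \<in> borel_measurable circle"
    unfolding y_def by (intro borel_measurable_lim_metric xm)
  have nn: "(\<integral>\<^sup>+z. ennreal ((cmod (y z - x n z))\<^sup>2) \<partial>circle) \<le> ennreal ((2 * (1/2) ^ n)\<^sup>2)" for n
  proof -
    have "AE z in circle. liminf (\<lambda>m. ennreal ((cmod (x m z - x n z))\<^sup>2)) = ennreal ((cmod (y z - x n z))\<^sup>2)"
      using conv
    proof eventually_elim
      case (elim z)
      then have "(\<lambda>m. x m z) \<longlonglongrightarrow> y z" by (simp add: y_def convergent_LIMSEQ_iff)
      then show ?case by (intro lim_imp_Liminf tendsto_intros) auto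
    qed
    then have "(\<integral>\<^sup>+z. ennreal ((cmod (y z - x n z))\<^sup>2) \<partial>circle) =
        (\<integral>\<^sup>+z. liminf (\<lambda>m. ennreal ((cmod (x m z - x n z))\<^sup>2)) \<partial>circle)"
      by (intro nn_integral_cong_AE) auto
    also have "\<dots> \<le> liminf (\<lambda>m. \<integral>\<^sup>+z. ennreal ((cmod (x m z - x n z))\<^sup>2) \<partial>circle)"
      by (intro nn_integral_liminf) measurable
    also have "\<dots> \<le> limsup (\<lambda>m. \<integral>\<^sup>+z. ennreal ((cmod (x m z - x n z))\<^sup>2) \<partial>circle)"
      by (intro Liminf_le_Limsup) simp
    also have "\<dots> \<le> ennreal ((2 * (1/2) ^ n)\<^sup>2)"
    proof (rule Limsup_bounded)
      show "\<forall>\<^sub>F m in sequentially. (\<integral>\<^sup>+z. ennreal ((cmod (x m z - x n z))\<^sup>2) \<partial>circle) \<le> ennreal ((2 * (1/2) ^ n)\<^sup>2)"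
        using eventually_ge_at_top[of n]
      proof eventually_elim
        case (elim m)
        have "(\<integral>\<^sup>+z. ennreal ((cmod (x m z - x n z))\<^sup>2) \<partial>circle) =
            ennreal (\<integral>z. (cmod (x m z - x n z))\<^sup>2 \<partial>circle)"
          using square_integrable_diff[OF x x, of m n]
          by (intro nn_integral_eq_integral) (auto simp: square_integrable_def)
        then show ?case using le[OF elim] by (simp add: ennreal_leI)
      qed
    qed
    finally show ?thesis .
  qed
  have si: "(\<lambda>z. y z - x n z) \<in> square_integrable" for n
  proof -
    have "integrable circle (\<lambda>z. (cmod (y z - x n z))\<^sup>2)"
      using nn[of n] by (intro integrableI_nonneg) (auto simp: top_unique less_top[symmetric])
    then show ?thesis by (simp add: square_integrable_def)
  qed
  show ?thesis
  proof (rule bexI[of _ y], rule allI)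
    show "y \<in> square_integrable"
      using square_integrable_add[OF si x, of 0 0] by simp
    show "(\<integral>z. (cmod (y z - x n z))\<^sup>2 \<partial>circle) \<le> (2 * (1/2) ^ n)\<^sup>2" for n
    proof -
      have "ennreal (\<integral>z. (cmod (y z - x n z))\<^sup>2 \<partial>circle) = (\<integral>\<^sup>+z. ennreal ((cmod (y z - x n z))\<^sup>2) \<partial>circle)"
        using si[of n] by (intro nn_integral_eq_integral[symmetric]) (auto simp: square_integrable_def)
      with nn[of n] have "ennreal (\<integral>z. (cmod (y z - x n z))\<^sup>2 \<partial>circle) \<le> ennreal ((2 * (1/2) ^ n)\<^sup>2)"
        by (rule ord_eq_le_trans[rotated])
      then show ?thesis by (subst (asm) ennreal_le_iff) (rule zero_le_power2)
    qed
  qed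
qed

instance L2 :: complete_space
proof
  fix X :: "nat \<Rightarrow> L2" assume X: "Cauchy X"
  have "\<exists>N. \<forall>i\<ge>N. \<forall>j\<ge>N. norm (X i - X j) < (1/2) ^ n" for n :: nat
    using X by (simp add: Cauchy_iff)
  then obtain N where N: "\<And>n i j. i \<ge> N n \<Longrightarrow> j \<ge> N n \<Longrightarrow> norm (X i - X j) < (1/2) ^ n"
    by metis
  obtain r :: "nat \<Rightarrow> nat" where r: "\<And>n. N n \<le> r n" "\<And>n. r n < r (Suc n)"
  proof -
    \<comment> \<open>A subsequence that moves by at most \<open>(1/2) ^ n\<close> after index
      \<open>n\<close>. A Cauchy sequence converges as soon as one of its subsequences does.\<close>
    have "\<exists>r. \<forall>n. N n \<le> r n \<and> r n < r (Suc n)"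
    proof (rule dependent_nat_choice)
      show "\<exists>y. N (Suc n) \<le> y \<and> x < y" for x n
        by (rule exI[of _ "Suc (x + N (Suc n))"]) simp
    qed (rule exI, rule order_refl)
    then show ?thesis using that by blast
  qed
  then have sr: "strict_mono r" by (simp add: strict_mono_Suc_iff)
  have near: "norm (X (r m) - X (r n)) \<le> (1/2) ^ n" if "n \<le> m" for m n
    using N[of n "r m" "r n"] r(1)[of n] strict_mono_less_eq[OF sr, of n m] that by simp
  define x where "x n = rep_L2 (X (r n))" for n
  have x: "x n \<in> square_integrable" for n
    unfolding x_def using Quotient3_rep_reflp[OF Quotient3_L2] by (rule AE_equal_D)
  have Xx: "X (r n) = abs_L2 (x n)" for n
    by (simp add: x_def Quotient3_abs_rep[OF Quotient3_L2])
  have norm_x: "(norm (abs_L2 f - X (r n)))\<^sup>2 = (\<integral>z. (cmod (f z - x n z))\<^sup>2 \<partial>circle)"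
    if "f \<in> square_integrable" for f n
    unfolding Xx[of n] abs_L2_diff[OF that x] norm_abs_L2[OF square_integrable_diff[OF that x]] ..
  have le: "(\<integral>z. (cmod (x m z - x n z))\<^sup>2 \<partial>circle) \<le> ((1/2) ^ n)\<^sup>2" if "n \<le> m" for m n
    unfolding norm_x[OF x, symmetric] Xx[of m, symmetric]
    by (intro power_mono near that norm_ge_zero)
  have conv: "AE z in circle. convergent (\<lambda>n. x n z)"
    by (intro AE_convergent_fast_Cauchy x le) simp
  have le': "(\<integral>z. (cmod (x m z - x n z))\<^sup>2 \<partial>circle) \<le> (2 * (1/2) ^ n)\<^sup>2" if "n \<le> m" for m n
    using le[OF that] by (rule order_trans) (intro power_mono, auto)
  have "\<exists>y\<in>square_integrable. \<forall>n. (\<integral>z. (cmod (y z - x n z))\<^sup>2 \<partial>circle) \<le> (2 * (1/2) ^ n)\<^sup>2"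
    by (rule L2_limit_fast_Cauchy[OF x conv le'])
  then obtain y where y: "y \<in> square_integrable"
    and y_le: "\<forall>n. (\<integral>z. (cmod (y z - x n z))\<^sup>2 \<partial>circle) \<le> (2 * (1/2) ^ n)\<^sup>2" ..
  have "norm (abs_L2 y - X (r n)) \<le> 2 * (1/2) ^ n" for n
  proof (rule power2_le_imp_le)
    show "(norm (abs_L2 y - X (r n)))\<^sup>2 \<le> (2 * (1/2) ^ n)\<^sup>2"
      unfolding norm_x[OF y] using y_le by (rule spec)
  qed simp
  moreover have "(\<lambda>n. 2 * (1/2) ^ n :: real) \<longlonglongrightarrow> 0"
    by (intro tendsto_mult_right_zero LIMSEQ_power_zero) simp
  ultimately have "(\<lambda>n. abs_L2 y - X (r n)) \<longlonglongrightarrow> 0"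
    by (rule Lim_null_comparison[OF always_eventually[OF allI]])
  then have "(\<lambda>n. abs_L2 y - (abs_L2 y - X (r n))) \<longlonglongrightarrow> abs_L2 y - 0"
    by (intro tendsto_diff tendsto_const)
  then have "(X \<circ> r) \<longlonglongrightarrow> abs_L2 y" by (simp add: o_def)
  then show "convergent X"
    using Cauchy_converges_subseq[OF X sr] by (auto simp: convergent_def)
qed

instance L2 :: banach ..

lemma square_integrable_cong_norm:
  assumes "f \<in> borel_measurable circle" "g \<in> borel_measurable circle"
    and "AE z in circle. cmod (f z) = cmod (g z)"
  shows "f \<in> square_integrable \<longleftrightarrow> g \<in> square_integrable"
proof -
  have "integrable circle (\<lambda>z. (cmod (f z))\<^sup>2) \<longleftrightarrow> integrable circle (\<lambda>z. (cmod (g z))\<^sup>2)"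
  proof (rule integrable_cong_AE)
    show "AE z in circle. (cmod (f z))\<^sup>2 = (cmod (g z))\<^sup>2"
      using assms(3) by eventually_elim simp
  qed (use assms in measurable)
  with assms show ?thesis by (simp add: square_integrable_def)
qed

lemma square_integrable_measurable: "f \<in> square_integrable \<Longrightarrow> f \<in> borel_measurable circle"
  by (simp add: square_integrable_def)

lemma square_integrable_mult_bounded:
  assumes "f \<in> square_integrable" "g \<in> square_integrable" "AE z in circle. cmod (f z) \<le> K"
  shows "(\<lambda>z. f z * g z) \<in> square_integrable"
proof -
  have m: "(\<lambda>z. f z * g z) \<in> borel_measurable circle"
    using assms by (intro borel_measurable_times square_integrable_measurable)
  have "integrable circle (\<lambda>z. (cmod (f z * g z))\<^sup>2)"
  proof (rule Bochner_Integration.integrable_bound)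
    show "integrable circle (\<lambda>z. K\<^sup>2 * (cmod (g z))\<^sup>2)"
      using assms(2) by (simp add: square_integrable_def)
    show "AE z in circle. norm ((cmod (f z * g z))\<^sup>2) \<le> norm (K\<^sup>2 * (cmod (g z))\<^sup>2)"
      using assms(3) by eventually_elim (simp add: norm_mult power_mult_distrib mult_right_mono power_mono)
  qed (use m in measurable)
  with m show ?thesis by (simp add: square_integrable_def)
qed

section \<open>The sesquilinear form\<close>

text \<open>The type class gives \<open>L2\<close> a real vector space structure only. Fourier sums
  and the sesquilinear form need complex multiples, which this separate operation supplies.\<close>

lift_definition cscale :: "complex \<Rightarrow> L2 \<Rightarrow> L2" is "\<lambda>c f z. c * f z"
  by (rule AE_equal_scale)

lemma cinner_add_left: "cinner (f + g) h = cinner f h + cinner g h"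
  by transfer (simp add: distrib_right square_integrable_prod AE_equal_D(1))

lemma cinner_cscale_left: "cinner (cscale c f) g = c * cinner f g"
  by transfer (simp add: mult.assoc)

lemma cinner_scaleR_left: "cinner (r *\<^sub>R f) g = r *\<^sub>R cinner f g"
  by transfer (simp add: mult.assoc scaleR_conv_of_real)

lemma cinner_commute: "cinner g f = cnj (cinner f g)"
proof transfer
  fix f g :: "complex \<Rightarrow> complex"
  show "(\<integral>z. g z * cnj (f z) \<partial>circle) = cnj (\<integral>z. f z * cnj (g z) \<partial>circle)"
    using Bochner_Integration.integral_cnj[of circle "\<lambda>z. f z * cnj (g z)"] by (simp add: mult.commute)
qed

lemma cinner_cscale_right: "cinner f (cscale c g) = cnj c * cinner f g"
  by (metis cinner_cscale_left cinner_commute complex_cnj_mult)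

lemma cinner_self: "cinner f f = of_real ((norm f)\<^sup>2)"
proof -
  have "Im (cinner f f) = 0" using cinner_commute[of f f] by (simp add: complex_eq_iff)
  moreover have "Re (cinner f f) = (norm f)\<^sup>2"
    by (simp add: power2_norm_eq_inner inner_L2_def)
  ultimately show ?thesis by (simp add: complex_eq_iff)
qed

lemma norm_cscale: "norm (cscale c f) = cmod c * norm f"
proof -
  have "complex_of_real ((norm (cscale c f))\<^sup>2) = (c * cnj c) * cinner f f"
    unfolding cinner_self[symmetric] by (simp add: cinner_cscale_left cinner_cscale_right)
  also have "\<dots> = of_real ((cmod c * norm f)\<^sup>2)"
    unfolding complex_norm_square[symmetric] cinner_self by (simp add: power_mult_distrib)
  finally have "complex_of_real ((norm (cscale c f))\<^sup>2) = of_real ((cmod c * norm f)\<^sup>2)" .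
  then show ?thesis by (simp only: of_real_eq_iff) (simp add: power2_eq_iff_nonneg)
qed

text \<open>Rotating \<open>f\<close> by a phase makes the form real and nonnegative, and the real
  Cauchy-Schwarz inequality applies.\<close>

lemma norm_cinner_le: "cmod (cinner f g) \<le> norm f * norm g"
proof -
  \<comment> \<open>The value 1 in the degenerate case keeps \<open>c\<close> of modulus one, as
    \<open>sgn 0\<close> is 0.\<close>
  define c where "c = (if cinner f g = 0 then 1 else cnj (sgn (cinner f g)))"
  have c: "cmod c = 1" by (simp add: c_def norm_sgn)
  have "c * cinner f g = of_real (cmod (cinner f g))"
    using complex_norm_square[of "cinner f g"]
    by (simp add: c_def sgn_eq power2_eq_square field_simps)
  then have "cmod (cinner f g) = inner (cscale c f) g"
    by (simp add: inner_L2_def cinner_cscale_left)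
  also have "\<dots> \<le> norm (cscale c f) * norm g" by (rule norm_cauchy_schwarz)
  finally show ?thesis by (simp add: norm_cscale c)
qed

text \<open>Real linearity in the first argument is enough to pull limits, sums and series out of
  the form; complex scalars are moved by \<open>cinner_cscale_left\<close>.\<close>

lemma bounded_linear_cinner: "bounded_linear (\<lambda>f. cinner f g)"
  by (rule bounded_linear_intro[where K = "norm g"])
    (simp_all add: cinner_add_left cinner_scaleR_left norm_cinner_le)

lemmas cinner_diff_left = linear_diff[OF bounded_linear.linear[OF bounded_linear_cinner]]
lemmas cinner_zero_left = linear_0[OF bounded_linear.linear[OF bounded_linear_cinner]]
lemmas cinner_sum_left = linear_sum[OF bounded_linear.linear[OF bounded_linear_cinner]]

lemma tendsto_cinner:
  assumes "(f \<longlongrightarrow> l) F"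
  shows "((\<lambda>x. cinner (f x) g) \<longlongrightarrow> cinner l g) F"
  using bounded_linear.tendsto[OF bounded_linear_cinner assms] .

section \<open>Pointwise operations\<close>

text \<open>The map \<open>C_u\<close> for \<open>u\<close> constantly 1. It exchanges
  \<open>H2\<close> with its orthogonal complement, and both the flip and all the conjugations
  \<open>C_u\<close> are built from it.\<close>

lift_definition L2_conj :: "L2 \<Rightarrow> L2" is "\<lambda>f z. cnj z * cnj (f z)"
proof -
  fix f g assume fg: "AE_equal f g"
  have ae: "AE z in circle. cnj z * cnj (f z) = cnj z * cnj (g z)"
    using AE_equal_D(3)[OF fg] by eventually_elim simp
  have "(\<lambda>z. cnj z * cnj (h z)) \<in> square_integrable" if "h \<in> square_integrable" for h
  proof (rule square_integrable_mult_bounded[where K = 1])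
    show "(\<lambda>z. cnj z) \<in> square_integrable"
      by (intro square_integrable_bounded[where K = 1] measurable_cnj circle_measurable_id) auto
    show "AE z in circle. cmod (cnj z) \<le> 1" by (intro AE_I2) (simp add: space_circle)
  qed (intro square_integrable_cnj that)
  with fg ae show "?thesis f g" by (simp add: AE_equal_def)
qed

lemmas L2_abs_eq = cinner.abs_eq L2_mult.abs_eq L2_cnj.abs_eq L2_hat.abs_eq flip.abs_eq
  unimodular.abs_eq essentially_bounded.abs_eq plus_L2.abs_eq minus_L2.abs_eq
  L2_conj.abs_eq AE_equal_refl

lemma circle_cnj_mult: "z \<in> space circle \<Longrightarrow> z * cnj z = 1" "z \<in> space circle \<Longrightarrow> cnj z * z = 1"
  using complex_norm_square[of z] by (simp_all add: space_circle mult.commute)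

lemma square_integrable_L2_conj:
  "f \<in> square_integrable \<Longrightarrow> (\<lambda>z. cnj z * cnj (f z)) \<in> square_integrable"
  using L2_conj.rsp by (auto simp: rel_fun_def AE_equal_def)

lemma square_integrable_L2_hat:
  "f \<in> square_integrable \<Longrightarrow> (\<lambda>z. cnj (f (cnj z))) \<in> square_integrable"
  by (intro square_integrable_cnj square_integrable_reflect)

lemma L2_conj_conj: "L2_conj (L2_conj f) = f"
proof (cases f)
  case (1 f')
  have "AE z in circle. cnj z * (z * f' z) = f' z"
    by (intro AE_I2) (simp add: circle_cnj_mult flip: mult.assoc)
  with 1 square_integrable_L2_conj[OF square_integrable_L2_conj[OF 1(1)]] show ?thesis
    by (auto simp: L2_abs_eq square_integrable_L2_conj intro!: abs_L2_eqI)
qed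

lemma L2_hat_hat: "L2_hat (L2_hat f) = f"
proof (cases f)
  case (1 f')
  then show ?thesis by (simp add: L2_abs_eq square_integrable_L2_hat)
qed

lemma L2_cnj_cnj: "L2_cnj (L2_cnj f) = f"
proof (cases f)
  case (1 f')
  then show ?thesis by (simp add: L2_abs_eq square_integrable_cnj)
qed

text \<open>The flip is linear, but it factors into two antilinear involutions. All its properties
  are read off from theirs.\<close>

lemma flip_eq: "flip f = L2_hat (L2_conj f)"
proof (cases f)
  case (1 f')
  then show ?thesis by (simp add: L2_abs_eq square_integrable_L2_conj)
qed

lemma L2_hat_conj: "L2_hat (L2_conj f) = L2_conj (L2_hat f)"
proof (cases f)
  case (1 f')
  then show ?thesis by (simp add: L2_abs_eq square_integrable_L2_conj square_integrable_L2_hat)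
qed

text \<open>Additivity together with the conjugated form yields isometry and compatibility with
  differences, hence continuity and the transport of orthogonality relations.\<close>

definition antiunitary :: "(L2 \<Rightarrow> L2) \<Rightarrow> bool" where
  "antiunitary V \<longleftrightarrow> (\<forall>f g. V (f + g) = V f + V g) \<and> (\<forall>f g. cinner (V f) (V g) = cnj (cinner f g))"

lemma antiunitary_L2_conj: "antiunitary L2_conj"
proof -
  have "L2_conj (f + g) = L2_conj f + L2_conj g" for f g
    by (cases f; cases g) (simp add: L2_abs_eq square_integrable_add square_integrable_L2_conj algebra_simps)
  moreover have "cinner (L2_conj f) (L2_conj g) = cnj (cinner f g)" for f g
  proof (cases f; cases g)
    fix f' g'
    assume *: "f' \<in> square_integrable" "f = abs_L2 f'" "g' \<in> square_integrable" "g = abs_L2 g'"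
    have "(\<integral>z. cnj z * cnj (f' z) * (z * g' z) \<partial>circle) = (\<integral>z. cnj (f' z * cnj (g' z)) \<partial>circle)"
      by (intro Bochner_Integration.integral_cong) (simp_all add: circle_cnj_mult flip: mult.assoc)
    then show ?thesis using * Bochner_Integration.integral_cnj[of circle "\<lambda>z. f' z * cnj (g' z)"]
      by (simp add: L2_abs_eq square_integrable_L2_conj)
  qed
  ultimately show ?thesis by (simp add: antiunitary_def)
qed

lemma antiunitary_L2_hat: "antiunitary L2_hat"
proof -
  have "L2_hat (f + g) = L2_hat f + L2_hat g" for f g
    by (cases f; cases g) (simp add: L2_abs_eq square_integrable_add square_integrable_L2_hat algebra_simps)
  moreover have "cinner (L2_hat f) (L2_hat g) = cnj (cinner f g)" for f g
  proof (cases f; cases g)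
    fix f' g'
    assume *: "f' \<in> square_integrable" "f = abs_L2 f'" "g' \<in> square_integrable" "g = abs_L2 g'"
    have "(\<integral>z. cnj (f' (cnj z)) * g' (cnj z) \<partial>circle) = (\<integral>z. cnj (f' z) * g' z \<partial>distr circle circle cnj)"
      using * by (intro integral_distr[symmetric] cnj_measurable_circle borel_measurable_times measurable_cnj
          square_integrable_measurable)
    also have "\<dots> = (\<integral>z. cnj (f' z * cnj (g' z)) \<partial>circle)"
      by (simp add: distr_circle_cnj)
    finally show ?thesis using * Bochner_Integration.integral_cnj[of circle "\<lambda>z. f' z * cnj (g' z)"]
      by (simp add: L2_abs_eq square_integrable_L2_hat)
  qed
  ultimately show ?thesis by (simp add: antiunitary_def)
qed

lemma L2_mult_commute: "f \<cdot> g = g \<cdot> f"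
  by (cases f; cases g) (simp add: L2_abs_eq mult.commute)

lemma square_integrable_cnj_iff: "(\<lambda>z. cnj (f z)) \<in> square_integrable \<longleftrightarrow> f \<in> square_integrable"
  using square_integrable_cnj[of f] square_integrable_cnj[of "\<lambda>z. cnj (f z)"] by auto

lemma square_integrable_reflect_iff: "(\<lambda>z. f (cnj z)) \<in> square_integrable \<longleftrightarrow> f \<in> square_integrable"
  using square_integrable_reflect[of f] square_integrable_reflect[of "\<lambda>z. f (cnj z)"] by auto

text \<open>No boundedness is assumed: a product is square integrable exactly when the product of
  the hats is, so both sides take the default value 0 together.\<close>

lemma L2_hat_mult: "L2_hat (f \<cdot> g) = L2_hat f \<cdot> L2_hat g"
proof (cases f; cases g)
  fix f' g'
  assume "f' \<in> square_integrable" "f = abs_L2 f'" "g' \<in> square_integrable" "g = abs_L2 g'"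
  moreover have "(\<lambda>z. cnj (f' (cnj z)) * cnj (g' (cnj z))) \<in> square_integrable \<longleftrightarrow>
      (\<lambda>z. f' z * g' z) \<in> square_integrable"
    using square_integrable_cnj_iff[of "\<lambda>z. f' (cnj z) * g' (cnj z)"]
      square_integrable_reflect_iff[of "\<lambda>z. f' z * g' z"] by simp
  ultimately show ?thesis
    by (auto simp: L2_abs_eq square_integrable_L2_hat square_integrable_const)
qed

lemma L2_conj_mult: "L2_conj (f \<cdot> g) = L2_cnj f \<cdot> L2_conj g"
proof (cases f; cases g)
  fix f' g'
  assume *: "f' \<in> square_integrable" "f = abs_L2 f'" "g' \<in> square_integrable" "g = abs_L2 g'"
  have "(\<lambda>z. cnj (f' z) * (cnj z * cnj (g' z))) \<in> square_integrable \<longleftrightarrow> (\<lambda>z. f' z * g' z) \<in> square_integrable"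
    using * by (intro square_integrable_cong_norm borel_measurable_times measurable_cnj circle_measurable_id
        square_integrable_measurable AE_I2) (simp_all add: norm_mult space_circle)
  with * show ?thesis
    by (auto simp: L2_abs_eq square_integrable_cnj square_integrable_L2_conj square_integrable_const mult_ac)
qed

lemma AE_unimodular_bounded: "AE z in circle. cmod (f z) = 1 \<Longrightarrow> AE z in circle. cmod (f z) \<le> 1"
  by (erule eventually_mono) simp

text \<open>With default values, associativity is a delicate matter. A unimodular first factor
  changes no modulus, so the triple product and \<open>f \<cdot> g\<close> are square integrable
  under the same condition. This allows arbitrary symbols \<open>\<phi>\<close> and arbitrary
  arguments in the operator identities.\<close>

lemma L2_mult_unimodular_assoc:
  assumes "unimodular u"
  shows "(u \<cdot> f) \<cdot> g = u \<cdot> (f \<cdot> g)"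
proof (cases u; cases f; cases g)
  fix u' f' g'
  assume *: "u' \<in> square_integrable" "u = abs_L2 u'" "f' \<in> square_integrable" "f = abs_L2 f'"
    "g' \<in> square_integrable" "g = abs_L2 g'"
  then have u: "AE z in circle. cmod (u' z) = 1" using assms by (simp add: L2_abs_eq)
  have s: "(\<lambda>z. u' z * h z) \<in> square_integrable" if "h \<in> square_integrable" for h
    using * AE_unimodular_bounded[OF u] that by (intro square_integrable_mult_bounded) auto
  have "AE z in circle. cmod (u' z * f' z * g' z) = cmod (f' z * g' z)"
    using u by eventually_elim (simp add: norm_mult)
  then have "(\<lambda>z. u' z * f' z * g' z) \<in> square_integrable \<longleftrightarrow> (\<lambda>z. f' z * g' z) \<in> square_integrable"
    using * by (intro square_integrable_cong_norm borel_measurable_times square_integrable_measurable)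
  with * s show ?thesis
    by (auto simp: L2_abs_eq square_integrable_const mult.assoc)
qed

lemma L2_mult_unimodular_left_commute:
  assumes "unimodular u"
  shows "f \<cdot> (u \<cdot> g) = u \<cdot> (f \<cdot> g)"
  using L2_mult_unimodular_assoc[OF assms, of g f] by (simp add: L2_mult_commute)

lemma unimodular_L2_cnj: "unimodular u \<Longrightarrow> unimodular (L2_cnj u)"
  by (cases u) (simp add: L2_abs_eq square_integrable_cnj)

lemma unimodular_L2_hat:
  assumes "unimodular u"
  shows "unimodular (L2_hat u)"
proof (cases u)
  case (1 u')
  then have "AE z in circle. cmod (u' z) = 1" using assms by (simp add: L2_abs_eq)
  from AE_circle_cnj[OF this] 1 show ?thesis
    by (simp add: L2_abs_eq square_integrable_L2_hat)
qed

lemma unimodular_cnj_mult: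
  assumes "unimodular u"
  shows "L2_cnj u \<cdot> (u \<cdot> f) = f"
proof (cases u; cases f)
  fix u' f'
  assume *: "u' \<in> square_integrable" "u = abs_L2 u'" "f' \<in> square_integrable" "f = abs_L2 f'"
  then have u: "AE z in circle. cmod (u' z) = 1" using assms by (simp add: L2_abs_eq)
  have s: "(\<lambda>z. u' z * f' z) \<in> square_integrable"
    using * AE_unimodular_bounded[OF u] by (intro square_integrable_mult_bounded) auto
  have ae: "AE z in circle. f' z = cnj (u' z) * (u' z * f' z)"
    using u
  proof eventually_elim
    case (elim z)
    then have "cnj (u' z) * u' z = 1" using complex_norm_square[of "u' z"] by (simp add: mult.commute)
    then show ?case by (simp flip: mult.assoc)
  qed
  have "AE z in circle. cmod (f' z) = cmod (cnj (u' z) * (u' z * f' z))"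
    using ae by eventually_elim (rule arg_cong)
  then have "f' \<in> square_integrable \<longleftrightarrow> (\<lambda>z. cnj (u' z) * (u' z * f' z)) \<in> square_integrable"
    using * by (intro square_integrable_cong_norm borel_measurable_times measurable_cnj square_integrable_measurable)
  with * s ae show ?thesis
    by (auto simp: L2_abs_eq square_integrable_cnj intro!: abs_L2_eqI)
qed

lemma unimodular_mult_cnj: "unimodular u \<Longrightarrow> u \<cdot> (L2_cnj u \<cdot> f) = f"
  using unimodular_cnj_mult[OF unimodular_L2_cnj] by (simp add: L2_cnj_cnj)

lemma cinner_unimodular:
  assumes "unimodular u"
  shows "cinner (u \<cdot> f) (u \<cdot> g) = cinner f g"
proof (cases u; cases f; cases g)
  fix u' f' g'
  assume *: "u' \<in> square_integrable" "u = abs_L2 u'" "f' \<in> square_integrable" "f = abs_L2 f'"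
    "g' \<in> square_integrable" "g = abs_L2 g'"
  then have u: "AE z in circle. cmod (u' z) = 1" using assms by (simp add: L2_abs_eq)
  have s: "(\<lambda>z. u' z * h z) \<in> square_integrable" if "h \<in> square_integrable" for h
    using * AE_unimodular_bounded[OF u] that by (intro square_integrable_mult_bounded) auto
  have "AE z in circle. u' z * f' z * cnj (u' z * g' z) = f' z * cnj (g' z)"
    using u
  proof eventually_elim
    case (elim z)
    then have "u' z * cnj (u' z) = 1" using complex_norm_square[of "u' z"] by simp
    moreover have "u' z * f' z * cnj (u' z * g' z) = (u' z * cnj (u' z)) * (f' z * cnj (g' z))"
      by (simp add: mult_ac)
    ultimately show ?case by (simp only: mult_1)
  qed
  then have "(\<integral>z. u' z * f' z * cnj (u' z * g' z) \<partial>circle) = (\<integral>z. f' z * cnj (g' z) \<partial>circle)"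
    using * by (intro integral_cong_AE borel_measurable_times measurable_cnj square_integrable_measurable)
  with * s show ?thesis by (simp add: L2_abs_eq)
qed

lemma cinner_unimodular_adjoint:
  assumes "unimodular u"
  shows "cinner (u \<cdot> f) g = cinner f (L2_cnj u \<cdot> g)"
  using cinner_unimodular[OF assms, of f "L2_cnj u \<cdot> g"] unimodular_mult_cnj[OF assms, of g] by simp

text \<open>Bounded factors keep all the products square integrable, so no default value interferes.
  This is the source of additivity for an unbounded symbol.\<close>

lemma L2_mult_essentially_bounded_add:
  assumes "essentially_bounded f" "essentially_bounded g"
  shows "\<phi> \<cdot> (f + g) = \<phi> \<cdot> f + \<phi> \<cdot> g"
proof (cases \<phi>; cases f; cases g)
  fix p f' g'
  assume *: "p \<in> square_integrable" "\<phi> = abs_L2 p" "f' \<in> square_integrable" "f = abs_L2 f'"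
    "g' \<in> square_integrable" "g = abs_L2 g'"
  obtain K where K: "AE z in circle. cmod (f' z) \<le> K" using assms(1) * by (auto simp: L2_abs_eq)
  obtain L where L: "AE z in circle. cmod (g' z) \<le> L" using assms(2) * by (auto simp: L2_abs_eq)
  have "(\<lambda>z. p z * f' z) \<in> square_integrable" "(\<lambda>z. p z * g' z) \<in> square_integrable"
    using square_integrable_mult_bounded[OF *(3) *(1) K] square_integrable_mult_bounded[OF *(5) *(1) L]
    by (simp_all add: mult.commute)
  moreover from this have "(\<lambda>z. p z * (f' z + g' z)) \<in> square_integrable"
    unfolding distrib_left by (rule square_integrable_add)
  ultimately show ?thesis using * by (simp add: L2_abs_eq square_integrable_add distrib_left)
qed

lemma L2_mult_unimodular_add:
  assumes "unimodular u"
  shows "u \<cdot> (f + g) = u \<cdot> f + u \<cdot> g"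
proof (cases u; cases f; cases g)
  fix u' f' g'
  assume *: "u' \<in> square_integrable" "u = abs_L2 u'" "f' \<in> square_integrable" "f = abs_L2 f'"
    "g' \<in> square_integrable" "g = abs_L2 g'"
  then have u: "AE z in circle. cmod (u' z) = 1" using assms by (simp add: L2_abs_eq)
  have s: "(\<lambda>z. u' z * h z) \<in> square_integrable" if "h \<in> square_integrable" for h
    using * AE_unimodular_bounded[OF u] that by (intro square_integrable_mult_bounded) auto
  with * s[of "\<lambda>z. f' z + g' z"] show ?thesis
    by (simp add: L2_abs_eq square_integrable_add distrib_left)
qed

lemma essentially_bounded_add:
  "essentially_bounded f \<Longrightarrow> essentially_bounded g \<Longrightarrow> essentially_bounded (f + g)"
proof (cases f; cases g)
  fix f' g'
  assume "essentially_bounded f" "essentially_bounded g" and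
    *: "f' \<in> square_integrable" "f = abs_L2 f'" "g' \<in> square_integrable" "g = abs_L2 g'"
  then obtain K L where K: "AE z in circle. cmod (f' z) \<le> K" and L: "AE z in circle. cmod (g' z) \<le> L"
    by (auto simp: L2_abs_eq)
  from K L have "AE z in circle. cmod (f' z + g' z) \<le> K + L"
    by eventually_elim (rule norm_triangle_mono)
  with * show ?thesis by (auto simp: L2_abs_eq square_integrable_add)
qed

lemma essentially_bounded_cscale: "essentially_bounded f \<Longrightarrow> essentially_bounded (cscale c f)"
proof (cases f)
  fix f'
  assume "essentially_bounded f" and *: "f' \<in> square_integrable" "f = abs_L2 f'"
  then obtain K where K: "AE z in circle. cmod (f' z) \<le> K"
    by (auto simp: L2_abs_eq)
  from K have "AE z in circle. cmod (c * f' z) \<le> cmod c * K"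
    by eventually_elim (simp add: norm_mult mult_left_mono)
  with * show ?thesis by (auto simp: L2_abs_eq cscale.abs_eq square_integrable_scale)
qed

lemma essentially_bounded_unimodular_mult:
  assumes "unimodular u" "essentially_bounded f"
  shows "essentially_bounded (u \<cdot> f)"
proof (cases u; cases f)
  fix u' f'
  assume *: "u' \<in> square_integrable" "u = abs_L2 u'" "f' \<in> square_integrable" "f = abs_L2 f'"
  then have u: "AE z in circle. cmod (u' z) = 1" using assms by (simp add: L2_abs_eq)
  obtain K where K: "AE z in circle. cmod (f' z) \<le> K"
    using * assms by (auto simp: L2_abs_eq)
  have "AE z in circle. cmod (u' z * f' z) \<le> K"
    using u K by eventually_elim (simp add: norm_mult)
  moreover have "(\<lambda>z. u' z * f' z) \<in> square_integrable"
    using * AE_unimodular_bounded[OF u] by (intro square_integrable_mult_bounded) auto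
  ultimately show ?thesis using * by (auto simp: L2_abs_eq)
qed

lemma essentially_bounded_L2_conj: "essentially_bounded f \<Longrightarrow> essentially_bounded (L2_conj f)"
proof (cases f)
  fix f'
  assume "essentially_bounded f" and *: "f' \<in> square_integrable" "f = abs_L2 f'"
  then obtain K where K: "AE z in circle. cmod (f' z) \<le> K"
    by (auto simp: L2_abs_eq)
  have "AE z in circle. cmod (cnj z * cnj (f' z)) \<le> K"
    using K AE_space[of circle] by eventually_elim (simp add: norm_mult space_circle)
  with * show ?thesis by (auto simp: L2_abs_eq square_integrable_L2_conj)
qed

lemma essentially_bounded_L2_hat: "essentially_bounded f \<Longrightarrow> essentially_bounded (L2_hat f)"
proof (cases f)
  fix f'
  assume "essentially_bounded f" and *: "f' \<in> square_integrable" "f = abs_L2 f'"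
  then obtain K where K: "AE z in circle. cmod (f' z) \<le> K"
    by (auto simp: L2_abs_eq)
  have "AE z in circle. cmod (cnj (f' (cnj z))) \<le> K"
    using AE_circle_cnj[OF K] by simp
  with * show ?thesis by (auto simp: L2_abs_eq square_integrable_L2_hat)
qed

section \<open>Trigonometric monomials\<close>

lift_definition zpow :: "int \<Rightarrow> L2" is "\<lambda>n z. z powi n"
  by (auto simp: AE_equal_refl circle_powi_measurable space_circle norm_power_int intro!: square_integrable_bounded[where K = 1])

lemma square_integrable_powi: "(\<lambda>z. z powi n) \<in> square_integrable"
  by (auto simp: circle_powi_measurable norm_power_int intro!: square_integrable_bounded[where K = 1])

lemma cnj_circle: "z \<in> space circle \<Longrightarrow> cnj z = inverse z"
  using inverse_unique[OF circle_cnj_mult(1)] by simp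

lemma cnj_powi_circle:
  assumes "z \<in> space circle"
  shows "cnj (z powi n) = z powi (- n)"
  by (simp add: complex_cnj_power_int cnj_circle[OF assms] power_int_inverse power_int_minus)

lemma space_circle_nonzero: "z \<in> space circle \<Longrightarrow> z \<noteq> 0"
  by (auto simp: space_circle)

lemma L2_cnj_zpow: "L2_cnj (zpow n) = zpow (- n)"
proof -
  have "AE z in circle. cnj (z powi n) = z powi (- n)" by (intro AE_I2 cnj_powi_circle)
  then show ?thesis
    using square_integrable_cnj[OF square_integrable_powi[of n]]
    by (auto simp: zpow.abs_eq L2_abs_eq square_integrable_powi simp del: complex_cnj_power_int
        intro!: abs_L2_eqI)
qed

lemma L2_hat_zpow: "L2_hat (zpow n) = zpow n"
  by (simp add: zpow.abs_eq L2_abs_eq square_integrable_powi complex_cnj_power_int)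

text \<open>The shift by one matters: \<open>n\<close> and \<open>- n - 1\<close> are never both
  nonnegative nor both negative, so frequencies of \<open>H2\<close> and of its complement are
  swapped without overlap at 0.\<close>

lemma L2_conj_zpow: "L2_conj (zpow n) = zpow (- n - 1)"
proof -
  have "cnj z * cnj (z powi n) = z powi (- n - 1)" if "z \<in> space circle" for z
  proof -
    have "cnj z = z powi (- 1)" using that by (simp add: cnj_circle power_int_minus)
    then have "cnj z * cnj (z powi n) = z powi (- 1) * z powi (- n)"
      using that by (simp only: cnj_powi_circle)
    also have "\<dots> = z powi (- 1 + - n)"
      using space_circle_nonzero[OF that] by (subst power_int_add) auto
    also have "- 1 + - n = - n - 1" by simp
    finally show ?thesis .
  qed
  then show ?thesis
    by (auto simp: zpow.abs_eq L2_abs_eq square_integrable_powi square_integrable_L2_conj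
        simp del: complex_cnj_power_int intro!: abs_L2_eqI AE_I2)
qed

lemma unimodular_zpow: "unimodular (zpow n)"
  by (auto simp: zpow.abs_eq L2_abs_eq square_integrable_powi space_circle norm_power_int intro!: AE_I2)

lemma essentially_bounded_zpow: "essentially_bounded (zpow n)"
  by (auto simp: zpow.abs_eq L2_abs_eq square_integrable_powi space_circle norm_power_int intro!: exI[of _ 1] AE_I2)

lemma zpow_mult: "zpow m \<cdot> zpow n = zpow (m + n)"
proof -
  have e: "z powi (m + n) = z powi m * z powi n" if "z \<in> space circle" for z
    using space_circle_nonzero[OF that] by (simp add: power_int_add)
  have "(\<lambda>z. z powi m * z powi n) \<in> square_integrable"
    by (rule square_integrable_mult_bounded[where K = 1])
      (auto simp: square_integrable_powi space_circle norm_power_int intro!: AE_I2)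
  then show ?thesis
    by (auto simp: zpow.abs_eq L2_abs_eq square_integrable_powi e intro!: abs_L2_eqI AE_I2)
qed

lemma cinner_zpow: "cinner (zpow m) (zpow n) = (if m = n then 1 else 0)"
proof -
  have "(\<integral>z. z powi m * cnj (z powi n) \<partial>circle) = (\<integral>z. z powi (m - n) \<partial>circle)"
  proof (intro Bochner_Integration.integral_cong refl)
    fix z assume z: "z \<in> space circle"
    show "z powi m * cnj (z powi n) = z powi (m - n)"
      using power_int_add[of z m "- n"] space_circle_nonzero[OF z] by (simp only: cnj_powi_circle[OF z]) simp
  qed
  then show ?thesis
    by (simp add: zpow.abs_eq L2_abs_eq square_integrable_powi integral_circle_powi)
qed

lemma fourier_unique_L2:
  assumes "\<And>n. cinner f (zpow n) = 0"
  shows "f = 0"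
proof (cases f)
  case (1 f')
  have "(\<integral>z. f' z * z powi m \<partial>circle) = 0" for m
  proof -
    have "(\<integral>z. f' z * z powi m \<partial>circle) = (\<integral>z. f' z * cnj (z powi (- m)) \<partial>circle)"
      by (intro Bochner_Integration.integral_cong refl) (simp only: cnj_powi_circle, simp)
    also have "\<dots> = cinner f (zpow (- m))"
      using 1 by (simp add: zpow.abs_eq L2_abs_eq square_integrable_powi)
    finally show ?thesis using assms by simp
  qed
  then have "AE z in circle. f' z = 0"
    using 1 by (intro fourier_coefficients_unique square_integrable_integrable)
  then show ?thesis
    using 1 by (auto simp: zero_L2_def square_integrable_const intro!: abs_L2_eqI)
qed

lemma antiunitary_cinner: "antiunitary V \<Longrightarrow> cinner (V f) (V g) = cnj (cinner f g)"
  by (simp add: antiunitary_def)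

lemma cinner_L2_conj_zpow: "cinner (L2_conj f) (zpow n) = cnj (cinner f (zpow (- n - 1)))"
  using antiunitary_cinner[OF antiunitary_L2_conj, of f "zpow (- n - 1)"] by (simp add: L2_conj_zpow)

lemma cinner_L2_hat_zpow: "cinner (L2_hat f) (zpow n) = cnj (cinner f (zpow n))"
  using antiunitary_cinner[OF antiunitary_L2_hat, of f "zpow n"] by (simp add: L2_hat_zpow)

lemma cinner_mult_zpow: "cinner (zpow k \<cdot> f) (zpow n) = cinner f (zpow (n - k))"
  by (simp add: cinner_unimodular_adjoint[OF unimodular_zpow] L2_cnj_zpow zpow_mult)

section \<open>One-sided Fourier series\<close>

lemma norm_zpow: "norm (zpow n) = 1"
  using cinner_self[of "zpow n"] norm_ge_zero[of "zpow n"]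
  by (auto simp: cinner_zpow complex_eq_iff power2_eq_1_iff simp del: norm_ge_zero)

lemma norm_sum_zpow:
  assumes "finite I"
  shows "(norm (\<Sum>n\<in>I. cscale (c n) (zpow (int n))))\<^sup>2 = (\<Sum>n\<in>I. (cmod (c n))\<^sup>2)"
proof -
  have "pairwise (\<lambda>i j. orthogonal (cscale (c i) (zpow (int i))) (cscale (c j) (zpow (int j)))) I"
    by (auto simp: pairwise_def orthogonal_def inner_L2_def cinner_cscale_left cinner_cscale_right cinner_zpow)
  from norm_sum_Pythagorean[OF assms this] show ?thesis
    by (simp add: norm_cscale norm_zpow)
qed

text \<open>Completeness of \<open>L2\<close> enters here through the Cauchy criterion, with blocks
  of the series measured by Pythagoras.\<close>

lemma summable_zpow:
  assumes "summable (\<lambda>n. (cmod (c n))\<^sup>2)"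
  shows "summable (\<lambda>n. cscale (c n) (zpow (int n)))"
  unfolding summable_Cauchy
proof (intro allI impI)
  fix e :: real assume e: "e > 0"
  then obtain N where N: "\<And>m n. m \<ge> N \<Longrightarrow> norm (\<Sum>k\<in>{m..<n}. (cmod (c k))\<^sup>2) < e\<^sup>2"
    using assms unfolding summable_Cauchy by (metis zero_less_power)
  have "norm (\<Sum>k\<in>{m..<n}. cscale (c k) (zpow (int k))) < e" if "m \<ge> N" for m n
  proof (rule power_less_imp_less_base)
    show "(norm (\<Sum>k\<in>{m..<n}. cscale (c k) (zpow (int k))))\<^sup>2 < e\<^sup>2"
      using N[OF that, of n] by (simp add: norm_sum_zpow)
  qed (use e in simp)
  then show "\<exists>N. \<forall>m\<ge>N. \<forall>n. norm (\<Sum>k\<in>{m..<n}. cscale (c k) (zpow (int k))) < e" by blast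
qed

lemma norm_suminf_zpow:
  assumes "summable (\<lambda>n. (cmod (c n))\<^sup>2)"
  shows "(norm (\<Sum>n. cscale (c n) (zpow (int n))))\<^sup>2 = (\<Sum>n. (cmod (c n))\<^sup>2)"
proof (rule LIMSEQ_unique)
  show "(\<lambda>N. \<Sum>n<N. (cmod (c n))\<^sup>2) \<longlonglongrightarrow> (\<Sum>n. (cmod (c n))\<^sup>2)"
    by (rule summable_LIMSEQ[OF assms])
  have "(\<lambda>N. (norm (\<Sum>n<N. cscale (c n) (zpow (int n))))\<^sup>2) \<longlonglongrightarrow> (norm (\<Sum>n. cscale (c n) (zpow (int n))))\<^sup>2"
    by (intro tendsto_intros summable_LIMSEQ summable_zpow assms)
  then show "(\<lambda>N. \<Sum>n<N. (cmod (c n))\<^sup>2) \<longlonglongrightarrow> (norm (\<Sum>n. cscale (c n) (zpow (int n))))\<^sup>2"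
    by (simp add: norm_sum_zpow)
qed

lemma cinner_suminf_zpow:
  assumes "summable (\<lambda>n. cscale (c n) (zpow (int n)))"
  shows "cinner (\<Sum>n. cscale (c n) (zpow (int n))) (zpow k) = (if k \<ge> 0 then c (nat k) else 0)"
proof -
  have "(\<lambda>n. cinner (cscale (c n) (zpow (int n))) (zpow k)) sums
      cinner (\<Sum>n. cscale (c n) (zpow (int n))) (zpow k)"
    by (rule bounded_linear.sums[OF bounded_linear_cinner summable_sums[OF assms]])
  moreover have "(\<lambda>n. cinner (cscale (c n) (zpow (int n))) (zpow k)) =
      (\<lambda>n. if n = nat k then (if k \<ge> 0 then c n else 0) else 0)"
    by (auto simp: cinner_cscale_left cinner_zpow fun_eq_iff)
  ultimately show ?thesis
    using sums_unique2[OF _ sums_single[of "nat k" "\<lambda>n. if k \<ge> 0 then c n else 0"]] by simp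
qed

lemma bessel:
  shows "summable (\<lambda>n. (cmod (cinner f (zpow (int n))))\<^sup>2)"
    and "(\<Sum>n. (cmod (cinner f (zpow (int n))))\<^sup>2) \<le> (norm f)\<^sup>2"
proof -
  have le: "(\<Sum>n<N. (cmod (cinner f (zpow (int n))))\<^sup>2) \<le> (norm f)\<^sup>2" for N
  proof -
    define S where "S = (\<Sum>n<N. cscale (cinner f (zpow (int n))) (zpow (int n)))"
    have S: "(norm S)\<^sup>2 = (\<Sum>n<N. (cmod (cinner f (zpow (int n))))\<^sup>2)"
      unfolding S_def by (rule norm_sum_zpow) simp
    \<comment> \<open>Pairing a partial sum with \<open>f\<close> returns the squared norm of that
      sum, so Cauchy-Schwarz gives \<open>norm S \<le> norm f\<close>.\<close>
    have "cinner S f = (\<Sum>n<N. complex_of_real ((cmod (cinner f (zpow (int n))))\<^sup>2))"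
      unfolding S_def cinner_sum_left complex_norm_square cinner_cscale_left
      by (intro sum.cong refl arg_cong2[where f = "(*)"] cinner_commute)
    then have "cinner S f = of_real ((norm S)\<^sup>2)" by (simp only: S of_real_sum)
    then have "(norm S)\<^sup>2 \<le> norm S * norm f"
      using norm_cinner_le[of S f] by (simp add: norm_power)
    then have "norm S \<le> norm f"
      by (cases "norm S = 0") (simp_all add: power2_eq_square)
    then show ?thesis unfolding S[symmetric] by (intro power_mono) auto
  qed
  show *: "summable (\<lambda>n. (cmod (cinner f (zpow (int n))))\<^sup>2)"
    by (rule summableI_nonneg_bounded[OF _ le]) auto
  show "(\<Sum>n. (cmod (cinner f (zpow (int n))))\<^sup>2) \<le> (norm f)\<^sup>2"
    by (rule suminf_le_const[OF * le])
qed

text \<open>The projection \<open>P\<close> as an explicit Fourier series. The \<open>THE\<close> in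
  \<open>orth_proj H2\<close> provides no witness; this series does, and it has computable
  coefficients.\<close>

definition hardy_proj :: "L2 \<Rightarrow> L2" where
  "hardy_proj f = (\<Sum>n. cscale (cinner f (zpow (int n))) (zpow (int n)))"

lemma summable_hardy_proj: "summable (\<lambda>n. cscale (cinner f (zpow (int n))) (zpow (int n)))"
  by (intro summable_zpow bessel)

lemma cinner_hardy_proj: "cinner (hardy_proj f) (zpow k) = (if k \<ge> 0 then cinner f (zpow k) else 0)"
  unfolding hardy_proj_def by (simp add: cinner_suminf_zpow summable_hardy_proj)

lemma hardy_proj_eq:
  assumes "\<And>k. k < 0 \<Longrightarrow> cinner f (zpow k) = 0"
  shows "hardy_proj f = f"
proof -
  have "f - hardy_proj f = 0"
    by (rule fourier_unique_L2) (auto simp: cinner_diff_left cinner_hardy_proj assms)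
  then show ?thesis by simp
qed

section \<open>Fourier characterization of the Hardy space\<close>

lemma norm_abs_L2_le:
  assumes "h \<in> square_integrable" "\<And>z. z \<in> space circle \<Longrightarrow> cmod (h z) \<le> K"
  shows "norm (abs_L2 h) \<le> \<bar>K\<bar>"
proof (rule power2_le_imp_le)
  have "(norm (abs_L2 h))\<^sup>2 = (\<integral>z. (cmod (h z))\<^sup>2 \<partial>circle)"
    by (rule norm_abs_L2[OF assms(1)])
  also have "\<dots> \<le> (\<integral>z. K\<^sup>2 \<partial>circle)"
  proof (rule integral_mono)
    show "(cmod (h z))\<^sup>2 \<le> K\<^sup>2" if "z \<in> space circle" for z
      using assms(2)[OF that] by (intro power_mono) auto
  qed (use assms in \<open>auto simp: square_integrable_def\<close>)
  finally show "(norm (abs_L2 h))\<^sup>2 \<le> \<bar>K\<bar>\<^sup>2" by (simp add: measure_circle)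
qed simp

text \<open>Absolute summability of the coefficients gives uniform convergence on the circle, and
  the uniform norm dominates the \<open>L2\<close> norm because the total mass is 1. This ties
  pointwise sums of power series to series in \<open>L2\<close>.\<close>

lemma sums_zpow_power_series:
  assumes b: "summable (\<lambda>n. cmod (b n))"
  defines "g \<equiv> \<lambda>z. \<Sum>n. b n * z ^ n"
  shows "g \<in> square_integrable"
    and "(\<lambda>n. cscale (b n) (zpow (int n))) sums abs_L2 g"
proof -
  have nz: "cmod (b n * z ^ n) = cmod (b n)" if "z \<in> space circle" for n z
    using that by (simp add: norm_mult norm_power space_circle)
  have sz: "summable (\<lambda>n. cmod (b n * z ^ n))" if "z \<in> space circle" for z
    using b by (simp add: nz[OF that])
  have tail: "cmod (g z - (\<Sum>n<N. b n * z ^ n)) \<le> (\<Sum>n. cmod (b (n + N)))" if "z \<in> space circle" for z N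
  proof -
    have "g z - (\<Sum>n<N. b n * z ^ n) = (\<Sum>n. b (n + N) * z ^ (n + N))"
      unfolding g_def using suminf_minus_initial_segment[OF summable_norm_cancel[OF sz[OF that]], of N] by simp
    also have "cmod \<dots> \<le> (\<Sum>n. cmod (b (n + N) * z ^ (n + N)))"
      by (rule summable_norm) (rule summable_ignore_initial_segment[OF sz[OF that]])
    also have "\<dots> = (\<Sum>n. cmod (b (n + N)))" by (simp only: nz[OF that])
    finally show ?thesis .
  qed
  have poly: "(\<lambda>z. \<Sum>n<N. b n * z ^ n) \<in> square_integrable \<and>
      (\<Sum>n<N. cscale (b n) (zpow (int n))) = abs_L2 (\<lambda>z. \<Sum>n<N. b n * z ^ n)" for N
  proof (induction N)
    case 0
    show ?case by (simp add: square_integrable_const zero_L2_def)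
  next
    case (Suc N)
    have t: "(\<lambda>z. b N * z ^ N) \<in> square_integrable"
      using square_integrable_scale[OF square_integrable_powi[of "int N"], of "b N"] by simp
    have "cscale (b N) (zpow (int N)) = abs_L2 (\<lambda>z. b N * z ^ N)"
      using square_integrable_powi[of "int N"] by (simp add: zpow.abs_eq cscale.abs_eq AE_equal_refl)
    with Suc t square_integrable_add[OF conjunct1[OF Suc] t] show ?case
      by (simp add: plus_L2.abs_eq AE_equal_refl)
  qed
  have "g \<in> borel_measurable circle"
    unfolding g_def
    by (intro borel_measurable_suminf borel_measurable_times borel_measurable_const borel_measurable_power circle_measurable_id)
  moreover have "cmod (g z) \<le> (\<Sum>n. cmod (b n))" if "z \<in> sphere 0 1" for z
    using tail[of z 0] that by (simp add: space_circle)
  ultimately show g: "g \<in> square_integrable" by (rule square_integrable_bounded)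
  have "(\<lambda>N. \<Sum>n. cmod (b (n + N))) = (\<lambda>N. (\<Sum>n. cmod (b n)) - (\<Sum>n<N. cmod (b n)))"
    using suminf_minus_initial_segment[OF b] by (simp add: fun_eq_iff)
  also have "\<dots> \<longlonglongrightarrow> (\<Sum>n. cmod (b n)) - (\<Sum>n. cmod (b n))"
    by (intro tendsto_intros summable_LIMSEQ b)
  finally have lim: "(\<lambda>N. \<Sum>n. cmod (b (n + N))) \<longlonglongrightarrow> 0" by simp
  have "(\<lambda>N. abs_L2 g - (\<Sum>n<N. cscale (b n) (zpow (int n)))) \<longlonglongrightarrow> 0"
  proof (rule Lim_null_comparison[OF always_eventually lim], rule allI)
    fix N
    have "norm (abs_L2 g - (\<Sum>n<N. cscale (b n) (zpow (int n)))) \<le> \<bar>\<Sum>n. cmod (b (n + N))\<bar>"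
      unfolding conjunct2[OF poly[of N]] abs_L2_diff[OF g conjunct1[OF poly[of N]]]
      by (intro norm_abs_L2_le square_integrable_diff g conjunct1[OF poly] tail)
    also have "\<dots> = (\<Sum>n. cmod (b (n + N)))"
      by (intro abs_of_nonneg suminf_nonneg summable_ignore_initial_segment[OF b] norm_ge_zero)
    finally show "norm (abs_L2 g - (\<Sum>n<N. cscale (b n) (zpow (int n)))) \<le> (\<Sum>n. cmod (b (n + N)))" .
  qed
  then have "(\<lambda>N. abs_L2 g - (abs_L2 g - (\<Sum>n<N. cscale (b n) (zpow (int n))))) \<longlonglongrightarrow> abs_L2 g - 0"
    by (intro tendsto_diff tendsto_const)
  then show "(\<lambda>n. cscale (b n) (zpow (int n))) sums abs_L2 g" by (simp add: sums_def)
qed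

lemma abs_L2_cong_circle:
  assumes "g \<in> square_integrable" "\<And>z. z \<in> space circle \<Longrightarrow> f z = g z"
  shows "f \<in> square_integrable" "abs_L2 f = abs_L2 g"
proof -
  have "f \<in> borel_measurable circle"
    using assms by (subst measurable_cong[of _ f g]) (auto simp: square_integrable_def)
  moreover have "integrable circle (\<lambda>z. (cmod (f z))\<^sup>2)"
    using assms by (subst Bochner_Integration.integrable_cong[of circle circle _ "\<lambda>z. (cmod (g z))\<^sup>2"])
      (auto simp: square_integrable_def)
  ultimately show "f \<in> square_integrable" by (simp add: square_integrable_def)
  then show "abs_L2 f = abs_L2 g" by (intro abs_L2_eqI assms AE_I2)
qed

lemma abs_L2_dilation:
  assumes F: "\<And>w. w \<in> ball 0 1 \<Longrightarrow> (\<lambda>n. a n * w ^ n) sums F w" and r: "0 \<le> r" "r < 1"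
  shows "(\<lambda>z. F (of_real r * z)) \<in> square_integrable"
    and "(\<lambda>n. cscale (a n * of_real r ^ n) (zpow (int n))) sums abs_L2 (\<lambda>z. F (of_real r * z))"
proof -
  \<comment> \<open>A radius strictly between \<open>r\<close> and 1: convergence there forces
    absolute convergence at \<open>r\<close>.\<close>
  define \<rho> where "\<rho> = (1 + r) / 2"
  have \<rho>: "\<bar>\<rho>\<bar> < 1" "r < \<bar>\<rho>\<bar>" using r by (simp_all add: \<rho>_def abs_if)
  then have "summable (\<lambda>n. a n * of_real \<rho> ^ n)"
    by (intro sums_summable[OF F]) simp
  then have s: "summable (\<lambda>n. cmod (a n * of_real r ^ n))"
    by (rule powser_insidea) (use r \<rho> in simp)
  have eq: "F (of_real r * z) = (\<Sum>n. a n * of_real r ^ n * z ^ n)" if "z \<in> space circle" for z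
    using F[of "of_real r * z"] that r
    by (simp add: sums_iff space_circle norm_mult power_mult_distrib mult.assoc)
  from abs_L2_cong_circle[OF sums_zpow_power_series(1)[OF s] eq] sums_zpow_power_series(2)[OF s]
  show "(\<lambda>z. F (of_real r * z)) \<in> square_integrable"
    and "(\<lambda>n. cscale (a n * of_real r ^ n) (zpow (int n))) sums abs_L2 (\<lambda>z. F (of_real r * z))"
    by simp_all
qed

text \<open>By its Taylor series each dilate contains only nonnegative frequencies, and Fourier
  coefficients are continuous under the mean-square limit.\<close>

lemma H2_subset_fourier:
  assumes "f \<in> H2" "k < 0"
  shows "cinner f (zpow k) = 0"
proof -
  obtain F where F: "F \<in> hardy_disk" and lim: "((\<lambda>r. abs_L2 (\<lambda>z. F (of_real r * z))) \<longlongrightarrow> f) (at_left 1)"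
    using assms by (auto simp: H2_def)
  define a where "a n = (deriv ^^ n) F 0 / fact n" for n
  have a: "(\<lambda>n. a n * w ^ n) sums F w" if "w \<in> ball 0 1" for w
    using holomorphic_power_series[of F 0 1 w] F that by (simp add: hardy_disk_def a_def)
  have "\<forall>\<^sub>F r in at_left (1::real). cinner (abs_L2 (\<lambda>z. F (of_real r * z))) (zpow k) = 0"
    using eventually_at_left_real[of 0 1]
  proof (rule eventually_mono)
    fix r :: real assume "r \<in> {0<..<1}"
    then have "(\<lambda>n. cscale (a n * of_real r ^ n) (zpow (int n))) sums abs_L2 (\<lambda>z. F (of_real r * z))"
      by (intro abs_L2_dilation a) auto
    then show "cinner (abs_L2 (\<lambda>z. F (of_real r * z))) (zpow k) = 0"
      using cinner_suminf_zpow[of "\<lambda>n. a n * of_real r ^ n" k] assms by (simp add: sums_iff)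
  qed simp
  then have "((\<lambda>r. cinner (abs_L2 (\<lambda>z. F (of_real r * z))) (zpow k)) \<longlongrightarrow> 0) (at_left 1)"
    by (rule tendsto_eventually)
  with tendsto_cinner[OF lim] show ?thesis
    by (intro tendsto_unique[of "at_left (1::real)"]) auto
qed

lemma cscale_diff_left: "cscale c x - cscale d x = cscale (c - d) x"
  by (cases x) (simp add: cscale.abs_eq AE_equal_refl square_integrable_scale abs_L2_diff left_diff_distrib)

text \<open>The Fourier coefficients of \<open>f\<close> serve as Taylor coefficients of
  \<open>F\<close>. Parseval's identity bounds the means over circles of radius \<open>r\<close>,
  and it expresses the squared distance from the dilate to \<open>f\<close> as a series that tends
  to 0 by dominated convergence.\<close>

lemma fourier_subset_H2:
  assumes "\<And>k. k < 0 \<Longrightarrow> cinner f (zpow k) = 0"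
  shows "f \<in> H2"
proof -
  define a where "a n = cinner f (zpow (int n))" for n
  define F where "F w = (\<Sum>n. a n * w ^ n)" for w
  have s2: "summable (\<lambda>n. (cmod (a n))\<^sup>2)" unfolding a_def by (rule bessel)
  have f: "f = (\<Sum>n. cscale (a n) (zpow (int n)))"
    using hardy_proj_eq[OF assms] by (simp add: hardy_proj_def a_def)
  have a_le: "cmod (a n) \<le> norm f" for n
    using norm_cinner_le[of f "zpow (int n)"] by (simp add: a_def norm_zpow)
  have F: "(\<lambda>n. a n * w ^ n) sums F w" if "w \<in> ball 0 1" for w
  proof -
    have "summable (\<lambda>n. a n * w ^ n)"
    proof (rule summable_comparison_test)
      show "summable (\<lambda>n. norm f * cmod w ^ n)"
        using that by (intro summable_mult summable_geometric) auto
      show "\<exists>N. \<forall>n\<ge>N. norm (a n * w ^ n) \<le> norm f * cmod w ^ n"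
        by (auto simp: norm_mult norm_power intro!: mult_right_mono a_le)
    qed
    then show ?thesis unfolding F_def by (rule summable_sums)
  qed
  then have hol: "F holomorphic_on ball 0 1"
    by (intro power_series_holomorphic[where a = a]) simp
  have r2: "(cmod (a n * c))\<^sup>2 \<le> (cmod (a n))\<^sup>2" if "cmod c \<le> 1" for n c
    using that by (intro power_mono) (auto simp: norm_mult mult_left_le)
  have s2': "summable (\<lambda>n. (cmod (a n * c n))\<^sup>2)" if "\<And>n. cmod (c n) \<le> 1" for c
    by (rule summable_comparison_test'[OF s2, of 0]) (simp only: norm_of_real real_norm_def abs_power2 r2[OF that])
  have "(\<integral>z. (cmod (F (of_real r * z)))\<^sup>2 \<partial>circle) \<le> (\<Sum>n. (cmod (a n))\<^sup>2)" if r: "r \<in> {0..<1}" for r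
  proof -
    have c1: "cmod (of_real r ^ n) \<le> 1" for n
      using r by (simp add: norm_power power_le_one)
    have "(\<integral>z. (cmod (F (of_real r * z)))\<^sup>2 \<partial>circle) = (norm (abs_L2 (\<lambda>z. F (of_real r * z))))\<^sup>2"
      using r by (intro norm_abs_L2[symmetric] abs_L2_dilation[OF F]) auto
    also have "abs_L2 (\<lambda>z. F (of_real r * z)) = (\<Sum>n. cscale (a n * of_real r ^ n) (zpow (int n)))"
      using abs_L2_dilation(2)[OF F, of r] r by (simp add: sums_iff)
    also have "(norm \<dots>)\<^sup>2 = (\<Sum>n. (cmod (a n * of_real r ^ n))\<^sup>2)"
      by (intro norm_suminf_zpow s2' c1)
    also have "\<dots> \<le> (\<Sum>n. (cmod (a n))\<^sup>2)"
      by (intro suminf_le s2 s2' c1 r2)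
    finally show ?thesis .
  qed
  with hol have "F \<in> hardy_disk" unfolding hardy_disk_def by blast
  moreover have "((\<lambda>r. abs_L2 (\<lambda>z. F (of_real r * z))) \<longlongrightarrow> f) (at_left 1)"
  proof -
    have c1: "cmod (of_real r ^ n - 1) \<le> 1" if "r \<in> {0<..<1}" for n and r :: real
    proof -
      have "complex_of_real r ^ n - 1 = of_real (r ^ n - 1)" by simp
      moreover have "0 \<le> r ^ n" "r ^ n \<le> 1" using that by (auto intro: power_le_one)
      ultimately show ?thesis by (simp only: norm_of_real abs_le_iff) linarith
    qed
    have ev: "\<forall>\<^sub>F r in at_left (1::real). (norm (abs_L2 (\<lambda>z. F (of_real r * z)) - f))\<^sup>2 =
        (\<Sum>n. (cmod (a n * (of_real r ^ n - 1)))\<^sup>2)"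
      using eventually_at_left_real[of 0 1]
    proof (rule eventually_mono)
      fix r :: real assume r: "r \<in> {0<..<1}"
      have "(\<lambda>n. cscale (a n) (zpow (int n))) sums f"
        by (subst f) (intro summable_sums summable_zpow s2)
      then have "(\<lambda>n. cscale (a n * of_real r ^ n) (zpow (int n)) - cscale (a n) (zpow (int n))) sums
          (abs_L2 (\<lambda>z. F (of_real r * z)) - f)"
        using r by (intro sums_diff abs_L2_dilation(2)[OF F]) auto
      also have "(\<lambda>n. cscale (a n * of_real r ^ n) (zpow (int n)) - cscale (a n) (zpow (int n))) =
          (\<lambda>n. cscale (a n * (of_real r ^ n - 1)) (zpow (int n)))"
        by (simp only: cscale_diff_left right_diff_distrib mult_1_right)
      finally have "abs_L2 (\<lambda>z. F (of_real r * z)) - f =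
          (\<Sum>n. cscale (a n * (of_real r ^ n - 1)) (zpow (int n)))"
        by (rule sums_unique)
      then show "(norm (abs_L2 (\<lambda>z. F (of_real r * z)) - f))\<^sup>2 =
          (\<Sum>n. (cmod (a n * (of_real r ^ n - 1)))\<^sup>2)"
        using norm_suminf_zpow[OF s2'[OF c1[OF r]]] by (simp only:)
    qed simp
    \<comment> \<open>Tannery's theorem with majorant \<open>(cmod (a n))\<^sup>2\<close>: each term
      tends to 0 as \<open>r\<close> tends to 1, and the factor \<open>of_real r ^ n - 1\<close> has
      modulus at most 1.\<close>
    have "((\<lambda>r. \<Sum>n. (cmod (a n * (of_real r ^ n - 1)))\<^sup>2) \<longlongrightarrow> (\<Sum>n. (0::real))) (at_left (1::real))"
    proof (rule tannerys_theorem[THEN conjunct2, THEN conjunct2])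
      show "((\<lambda>r. (cmod (a n * (of_real r ^ n - 1)))\<^sup>2) \<longlongrightarrow> 0) (at_left (1::real))" for n
        by (rule tendsto_eq_intros refl | simp)+
      have "\<forall>\<^sub>F x in sequentially \<times>\<^sub>F at_left (1::real). True \<and> snd x \<in> {0<..<1}"
        using eventually_prodI[OF eventually_True eventually_at_left_real[of 0 1]] by simp
      then show "\<forall>\<^sub>F (n, r) in sequentially \<times>\<^sub>F at_left (1::real).
          norm ((cmod (a n * (of_real r ^ n - 1)))\<^sup>2) \<le> (cmod (a n))\<^sup>2"
      proof (rule eventually_mono)
        fix x :: "nat \<times> real" assume x: "True \<and> snd x \<in> {0<..<1}"
        obtain n r where nr: "x = (n, r)" by (cases x)
        with x have "r \<in> {0<..<1}" by simp
        then show "case x of (n, r) \<Rightarrow> norm ((cmod (a n * (of_real r ^ n - 1)))\<^sup>2) \<le> (cmod (a n))\<^sup>2"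
          unfolding nr prod.case real_norm_def abs_power2 by (intro r2 c1)
      qed
    qed (simp_all add: s2)
    then have "((\<lambda>r. (norm (abs_L2 (\<lambda>z. F (of_real r * z)) - f))\<^sup>2) \<longlongrightarrow> 0) (at_left 1)"
      unfolding filterlim_cong[OF refl refl ev] suminf_zero .
    then have "((\<lambda>r. sqrt ((norm (abs_L2 (\<lambda>z. F (of_real r * z)) - f))\<^sup>2)) \<longlongrightarrow> sqrt 0) (at_left 1)"
      by (rule tendsto_real_sqrt)
    then show ?thesis unfolding real_sqrt_abs real_sqrt_zero abs_norm_cancel
      by (rule Lim_null[THEN iffD2, OF tendsto_norm_zero_cancel])
  qed
  ultimately show ?thesis by (auto simp: H2_def)
qed

lemma H2_iff: "f \<in> H2 \<longleftrightarrow> (\<forall>k<0. cinner f (zpow k) = 0)"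
  using H2_subset_fourier fourier_subset_H2 by blast

section \<open>Orthogonal projections\<close>

lemma antiunitary_add: "antiunitary V \<Longrightarrow> V (f + g) = V f + V g"
  by (simp add: antiunitary_def)

lemma antiunitary_diff: "antiunitary V \<Longrightarrow> V (f - g) = V f - V g"
  using antiunitary_add[of V "f - g" g] by simp

lemma antiunitary_norm:
  assumes "antiunitary V"
  shows "norm (V f) = norm f"
proof -
  have "(norm (V f))\<^sup>2 = (norm f)\<^sup>2"
    using antiunitary_cinner[OF assms, of f f] by (simp add: power2_norm_eq_inner inner_L2_def)
  then show ?thesis by simp
qed

lemma antiunitary_tendsto:
  assumes "antiunitary V" "(h \<longlongrightarrow> l) F"
  shows "((\<lambda>x. V (h x)) \<longlongrightarrow> V l) F"
proof -
  have "((\<lambda>x. norm (h x - l)) \<longlongrightarrow> 0) F"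
    using assms(2) by (simp add: tendsto_norm_zero_iff flip: Lim_null)
  then have "((\<lambda>x. norm (V (h x) - V l)) \<longlongrightarrow> 0) F"
    by (simp add: antiunitary_norm[OF assms(1)] flip: antiunitary_diff[OF assms(1)])
  then show ?thesis by (simp add: tendsto_norm_zero_iff flip: Lim_null)
qed

text \<open>Two candidates differ by an element of \<open>S\<close> that is orthogonal to itself.
  Evaluating \<open>orth_proj\<close> thus amounts to exhibiting a candidate.\<close>

lemma orth_proj_eqI:
  assumes S: "\<And>x y. x \<in> S \<Longrightarrow> y \<in> S \<Longrightarrow> x - y \<in> S"
    and g: "g \<in> S" "\<And>h. h \<in> S \<Longrightarrow> cinner (f - g) h = 0"
  shows "orth_proj S f = g"
  unfolding orth_proj_def
proof (rule the_equality)
  fix k assume k: "k \<in> S \<and> (\<forall>h\<in>S. cinner (f - k) h = 0)"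
  have gk: "g - k \<in> S" using S g k by blast
  have "cinner (g - k) (g - k) = cinner (f - k) (g - k) - cinner (f - g) (g - k)"
    by (simp add: cinner_diff_left)
  then have "cinner (g - k) (g - k) = 0" using k g(2) gk by simp
  then show "k = g" by (simp add: cinner_self)
qed (use g in simp)

lemma H2_add: "f \<in> H2 \<Longrightarrow> g \<in> H2 \<Longrightarrow> f + g \<in> H2"
  by (simp add: H2_iff cinner_add_left)

lemma H2_diff: "f \<in> H2 \<Longrightarrow> g \<in> H2 \<Longrightarrow> f - g \<in> H2"
  by (simp add: H2_iff cinner_diff_left)

lemma hardy_proj_H2: "hardy_proj f \<in> H2"
  by (simp add: H2_iff cinner_hardy_proj)

lemma zpow_H2: "zpow (int n) \<in> H2"
  by (simp add: H2_iff cinner_zpow)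

lemma hardy_proj_H2_eq: "f \<in> H2 \<Longrightarrow> hardy_proj f = f"
  by (rule hardy_proj_eq) (simp add: H2_iff)

text \<open>An element of \<open>H2\<close> is the sum of its Fourier series, so orthogonality may
  be tested on monomials.\<close>

lemma H2_orthogonalI:
  assumes "\<And>n. cinner f (zpow (int n)) = 0" "h \<in> H2"
  shows "cinner f h = 0"
proof -
  have "(\<lambda>n. cinner (cscale (cinner h (zpow (int n))) (zpow (int n))) f) sums cinner (hardy_proj h) f"
    unfolding hardy_proj_def
    by (rule bounded_linear.sums[OF bounded_linear_cinner summable_sums[OF summable_hardy_proj]])
  moreover have "cinner (zpow (int n)) f = 0" for n
    using assms(1)[of n] cinner_commute[of "zpow (int n)" f] by simp
  ultimately have "cinner (hardy_proj h) f = 0"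
    by (simp add: cinner_cscale_left sums_iff)
  then show ?thesis
    using assms(2) cinner_commute[of f h] by (simp add: hardy_proj_H2_eq)
qed

lemma cinner_hardy_proj_orthogonal: "h \<in> H2 \<Longrightarrow> cinner (f - hardy_proj f) h = 0"
  by (rule H2_orthogonalI) (simp_all add: cinner_diff_left cinner_hardy_proj)

lemma cinner_hardy_proj_H2: "h \<in> H2 \<Longrightarrow> cinner (hardy_proj f) h = cinner f h"
  using cinner_hardy_proj_orthogonal[of h f] by (simp add: cinner_diff_left)

lemma orth_proj_H2: "orth_proj H2 f = hardy_proj f"
  by (rule orth_proj_eqI) (auto intro: H2_diff hardy_proj_H2 cinner_hardy_proj_orthogonal)

lemma closed_H2: "closed H2"
proof -
  have eq: "H2 = (\<Inter>k\<in>{..<0}. {f. cinner f (zpow k) = 0})"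
    using H2_iff by blast
  show ?thesis
    unfolding eq
    by (intro closed_INT ballI closed_Collect_eq linear_continuous_on bounded_linear_cinner continuous_on_const)
qed

text \<open>Boundary functions are multiplied without recourse to their extensions to the disk:
  \<open>v\<close> is moved to the other side of the form, and for \<open>k < 0\<close> the function
  \<open>L2_cnj v \<cdot> zpow k\<close> has only negative frequencies, hence is orthogonal to
  \<open>H2\<close>.\<close>

lemma inner_mult_H2:
  assumes v: "inner_function v" and g: "g \<in> H2"
  shows "v \<cdot> g \<in> H2"
  unfolding H2_iff
proof (intro allI impI)
  fix k :: int assume k: "k < 0"
  have uv: "unimodular v" and vH: "v \<in> H2" using v by (simp_all add: inner_function_def)
  have "cinner g (L2_cnj v \<cdot> zpow k) = 0"
  proof -
    have "cinner (L2_cnj v \<cdot> zpow k) (zpow (int n)) = 0" for n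
    proof -
      have "cinner (L2_cnj v \<cdot> zpow k) (zpow (int n)) = cnj (cinner v (zpow (k - int n)))"
        using cinner_mult_zpow[of "int n" v k] cinner_unimodular_adjoint[OF uv, of "zpow (int n)" "zpow k"]
          cinner_commute[of "L2_cnj v \<cdot> zpow k" "zpow (int n)"]
        by (simp add: L2_mult_commute)
      then show ?thesis using vH k by (simp add: H2_iff)
    qed
    from H2_orthogonalI[OF this g] show ?thesis
      using cinner_commute[of g "L2_cnj v \<cdot> zpow k"] by simp
  qed
  then show "cinner (v \<cdot> g) (zpow k) = 0"
    by (simp add: cinner_unimodular_adjoint[OF uv])
qed

lemma L2_conj_H2_iff: "L2_conj y \<in> H2 \<longleftrightarrow> (\<forall>g\<in>H2. cinner y g = 0)"
proof
  assume y: "L2_conj y \<in> H2"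
  have "cinner y (zpow (int n)) = 0" for n
  proof -
    have "cinner (L2_conj y) (zpow (- int n - 1)) = 0" using y by (simp add: H2_iff)
    then show ?thesis by (simp add: cinner_L2_conj_zpow)
  qed
  then show "\<forall>g\<in>H2. cinner y g = 0" using H2_orthogonalI by blast
next
  assume y: "\<forall>g\<in>H2. cinner y g = 0"
  show "L2_conj y \<in> H2"
    unfolding H2_iff
  proof (intro allI impI)
    fix k :: int assume "k < 0"
    then have "zpow (- k - 1) \<in> H2" using zpow_H2[of "nat (- k - 1)"] by simp
    then show "cinner (L2_conj y) (zpow k) = 0" using y by (simp add: cinner_L2_conj_zpow)
  qed
qed

lemma L2_hat_H2_iff: "L2_hat f \<in> H2 \<longleftrightarrow> f \<in> H2"
  by (simp add: H2_iff cinner_L2_hat_zpow)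

lemma inner_function_hat: "inner_function u \<Longrightarrow> inner_function (L2_hat u)"
  by (simp add: inner_function_def L2_hat_H2_iff unimodular_L2_hat)

section \<open>Model spaces: their symmetries and the formula for the projection\<close>

definition model_conj :: "L2 \<Rightarrow> L2 \<Rightarrow> L2" where
  "model_conj u f = u \<cdot> L2_conj f"

lemma antiunitary_model_conj: "unimodular u \<Longrightarrow> antiunitary (model_conj u)"
  unfolding antiunitary_def model_conj_def
  by (simp add: L2_mult_unimodular_add cinner_unimodular antiunitary_add[OF antiunitary_L2_conj]
      antiunitary_cinner[OF antiunitary_L2_conj])

lemma model_conj_conj: "unimodular u \<Longrightarrow> model_conj u (model_conj u f) = f"
  by (simp add: model_conj_def L2_conj_mult L2_conj_conj unimodular_mult_cnj)

text \<open>Orthogonality to \<open>u H2\<close> says that \<open>L2_cnj u \<cdot> f\<close> is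
  orthogonal to \<open>H2\<close>, which by \<open>L2_conj_H2_iff\<close> means that its
  \<open>L2_conj\<close>, namely \<open>model_conj u f\<close>, lies in \<open>H2\<close>. In this
  form the involution visibly swaps the two conditions.\<close>

lemma model_space_iff:
  assumes "unimodular u"
  shows "f \<in> model_space u \<longleftrightarrow> f \<in> H2 \<and> model_conj u f \<in> H2"
proof -
  have "cinner f (u \<cdot> g) = cinner (L2_cnj u \<cdot> f) g" for g
    using cinner_unimodular_adjoint[OF unimodular_L2_cnj[OF assms], of f g] by (simp add: L2_cnj_cnj)
  then show ?thesis
    using L2_conj_H2_iff[of "L2_cnj u \<cdot> f"]
    by (simp add: model_space_def model_conj_def L2_conj_mult L2_cnj_cnj)
qed

lemma model_conj_model_space:
  "unimodular u \<Longrightarrow> f \<in> model_space u \<Longrightarrow> model_conj u f \<in> model_space u"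
  by (simp add: model_space_iff model_conj_conj)

lemma L2_hat_model_space:
  assumes "unimodular u"
  shows "f \<in> model_space u \<Longrightarrow> L2_hat f \<in> model_space (L2_hat u)"
  using assms L2_hat_H2_iff[of "u \<cdot> L2_conj f"]
  by (simp add: model_space_iff unimodular_L2_hat L2_hat_H2_iff model_conj_def L2_hat_conj L2_hat_mult)

lemma L2_hat_model_space':
  assumes "unimodular u"
  shows "f \<in> model_space (L2_hat u) \<Longrightarrow> L2_hat f \<in> model_space u"
  using L2_hat_model_space[OF unimodular_L2_hat[OF assms]] by (simp add: L2_hat_hat)

lemma bounded_model_conj:
  "unimodular u \<Longrightarrow> f \<in> bounded_model_space u \<Longrightarrow> model_conj u f \<in> bounded_model_space u"
  unfolding bounded_model_space_def
  by (simp add: model_conj_model_space) (simp add: model_conj_def essentially_bounded_unimodular_mult essentially_bounded_L2_conj)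

lemma bounded_L2_hat':
  "unimodular u \<Longrightarrow> f \<in> bounded_model_space (L2_hat u) \<Longrightarrow> L2_hat f \<in> bounded_model_space u"
  by (simp add: bounded_model_space_def L2_hat_model_space' essentially_bounded_L2_hat)

lemma model_space_add: "f \<in> model_space u \<Longrightarrow> g \<in> model_space u \<Longrightarrow> f + g \<in> model_space u"
  by (simp add: model_space_def H2_add cinner_add_left)

lemma model_space_diff: "f \<in> model_space u \<Longrightarrow> g \<in> model_space u \<Longrightarrow> f - g \<in> model_space u"
  by (simp add: model_space_def H2_diff cinner_diff_left)

lemma model_space_cscale: "f \<in> model_space u \<Longrightarrow> cscale c f \<in> model_space u"
  by (simp add: model_space_def H2_iff cinner_cscale_left)

lemma closed_model_space:
  assumes "unimodular u"
  shows "closed (model_space u)"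
proof -
  have "model_space u = H2 \<inter> model_conj u -` H2"
    using model_space_iff[OF assms] by blast
  moreover have "closed (model_conj u -` H2)"
    using antiunitary_tendsto[OF antiunitary_model_conj[OF assms] tendsto_ident_at]
    by (intro continuous_closed_vimage closed_H2) (simp add: continuous_at)
  ultimately show ?thesis by (simp add: closed_Int closed_H2)
qed

text \<open>The classical formula \<open>P_v = P - v P cnj(v)\<close>: multiplication by
  \<open>v\<close> is unitary, so the subtracted term is the projection onto \<open>v H2\<close>, a
  subspace of \<open>H2\<close> whose complement in \<open>H2\<close> is the model space.\<close>

lemma orth_proj_model_space:
  assumes v: "inner_function v"
  shows "orth_proj (model_space v) f = hardy_proj f - v \<cdot> hardy_proj (L2_cnj v \<cdot> f)"
    and "orth_proj (model_space v) f \<in> model_space v"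
    and "h \<in> model_space v \<Longrightarrow> cinner (f - orth_proj (model_space v) f) h = 0"
proof -
  define g where "g = hardy_proj f - v \<cdot> hardy_proj (L2_cnj v \<cdot> f)"
  have uv: "unimodular v" using v by (simp add: inner_function_def)
  have vv: "cinner x (v \<cdot> y) = cinner (L2_cnj v \<cdot> x) y" for x y
    using cinner_unimodular_adjoint[OF unimodular_L2_cnj[OF uv], of x y] by (simp add: L2_cnj_cnj)
  have g: "g \<in> model_space v"
    unfolding model_space_def
  proof (intro CollectI conjI ballI)
    show "g \<in> H2"
      unfolding g_def by (intro H2_diff hardy_proj_H2 inner_mult_H2 v)
    fix y assume y: "y \<in> H2"
    have "cinner (v \<cdot> hardy_proj (L2_cnj v \<cdot> f)) (v \<cdot> y) = cinner f (v \<cdot> y)"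
      unfolding cinner_unimodular[OF uv] cinner_hardy_proj_H2[OF y] by (rule vv[symmetric])
    then show "cinner g (v \<cdot> y) = 0"
      by (simp add: g_def cinner_diff_left cinner_hardy_proj_H2 inner_mult_H2[OF v y])
  qed
  have orth: "cinner (f - g) h = 0" if h: "h \<in> model_space v" for h
  proof -
    have "cinner (v \<cdot> hardy_proj (L2_cnj v \<cdot> f)) h = 0"
      using h cinner_commute[of "v \<cdot> hardy_proj (L2_cnj v \<cdot> f)" h] by (simp add: model_space_def hardy_proj_H2)
    moreover have "cinner (hardy_proj f) h = cinner f h"
      using h by (simp add: model_space_def cinner_hardy_proj_H2)
    ultimately show ?thesis by (simp add: g_def cinner_diff_left)
  qed
  have eq: "orth_proj (model_space v) f = g"
    by (rule orth_proj_eqI[OF model_space_diff g orth])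
  show "orth_proj (model_space v) f = hardy_proj f - v \<cdot> hardy_proj (L2_cnj v \<cdot> f)"
    using eq by (simp add: g_def)
  show "orth_proj (model_space v) f \<in> model_space v" using eq g by simp
  show "h \<in> model_space v \<Longrightarrow> cinner (f - orth_proj (model_space v) f) h = 0"
    using eq orth by simp
qed

lemma orth_proj_model_space_eqI:
  "g \<in> model_space v \<Longrightarrow> (\<And>h. h \<in> model_space v \<Longrightarrow> cinner (f - g) h = 0) \<Longrightarrow>
    orth_proj (model_space v) f = g"
  by (rule orth_proj_eqI[OF model_space_diff])

lemma orth_proj_model_space_diff:
  assumes "inner_function v"
  shows "orth_proj (model_space v) (f - g) = orth_proj (model_space v) f - orth_proj (model_space v) g"
proof (rule orth_proj_model_space_eqI)
  fix h assume "h \<in> model_space v"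
  then show "cinner (f - g - (orth_proj (model_space v) f - orth_proj (model_space v) g)) h = 0"
    using orth_proj_model_space(3)[OF assms, of h f] orth_proj_model_space(3)[OF assms, of h g]
    by (simp add: cinner_diff_left)
qed (intro model_space_diff orth_proj_model_space(2)[OF assms])

lemma norm_orth_proj_model_space_le:
  assumes "inner_function v"
  shows "norm (orth_proj (model_space v) f) \<le> norm f"
proof -
  define g where "g = orth_proj (model_space v) f"
  have "cinner (f - g) g = 0"
    unfolding g_def by (intro orth_proj_model_space assms)
  then have "complex_of_real ((norm g)\<^sup>2) = cinner f g"
    by (simp add: cinner_diff_left cinner_self)
  then have "(norm g)\<^sup>2 \<le> norm f * norm g"
    using norm_cinner_le[of f g] by (metis norm_of_real abs_of_nonneg zero_le_power2)
  then show ?thesis unfolding g_def[symmetric]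
    by (cases "norm g = 0") (simp_all add: power2_eq_square)
qed

text \<open>An antiunitary map that carries one model space onto another carries the orthogonality
  relations along, and these determine the projection.\<close>

lemma orth_proj_antiunitary:
  assumes V: "antiunitary V" and inner: "inner_function v" and VS: "\<And>h. h \<in> model_space v \<Longrightarrow> V h \<in> model_space v'"
    and surj: "\<And>h. h \<in> model_space v' \<Longrightarrow> \<exists>h'\<in>model_space v. h = V h'"
  shows "orth_proj (model_space v') (V f) = V (orth_proj (model_space v) f)"
proof (rule orth_proj_model_space_eqI)
  show "V (orth_proj (model_space v) f) \<in> model_space v'"
    by (intro VS orth_proj_model_space inner)
  fix h assume "h \<in> model_space v'"
  then obtain h' where h': "h' \<in> model_space v" "h = V h'" using surj by blast
  then show "cinner (V f - V (orth_proj (model_space v) f)) h = 0"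
    using orth_proj_model_space(3)[OF inner h'(1), of f]
    by (simp add: antiunitary_cinner[OF V] flip: antiunitary_diff[OF V])
qed

lemma orth_proj_model_conj:
  assumes "inner_function v"
  shows "orth_proj (model_space v) (model_conj v f) = model_conj v (orth_proj (model_space v) f)"
proof -
  have u: "unimodular v" using assms by (simp add: inner_function_def)
  show ?thesis
  proof (rule orth_proj_antiunitary[OF antiunitary_model_conj[OF u] assms model_conj_model_space[OF u]])
    show "\<exists>h'\<in>model_space v. h = model_conj v h'" if "h \<in> model_space v" for h
      using model_conj_model_space[OF u that] by (rule bexI[rotated]) (simp add: model_conj_conj[OF u])
  qed
qed

lemma orth_proj_L2_hat:
  assumes "inner_function v"
  shows "orth_proj (model_space (L2_hat v)) (L2_hat f) = L2_hat (orth_proj (model_space v) f)"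
proof -
  have u: "unimodular v" using assms by (simp add: inner_function_def)
  show ?thesis
  proof (rule orth_proj_antiunitary[OF antiunitary_L2_hat assms L2_hat_model_space[OF u]])
    show "\<exists>h'\<in>model_space v. h = L2_hat h'" if "h \<in> model_space (L2_hat v)" for h
      using L2_hat_model_space'[OF u that] by (rule bexI[rotated]) (simp add: L2_hat_hat)
  qed
qed

section \<open>Density of the bounded functions\<close>

text \<open>As \<open>v\<close> has no negative frequencies,
  \<open>L2_cnj v \<cdot> zpow (int k)\<close> has none above \<open>k\<close>. Its projection to
  \<open>H2\<close> is therefore a polynomial.\<close>

lemma hardy_proj_analytic_polynomial:
  assumes v: "v \<in> H2" "unimodular v"
  shows "hardy_proj (L2_cnj v \<cdot> zpow (int k)) =
    (\<Sum>n\<le>k. cscale (cinner (L2_cnj v \<cdot> zpow (int k)) (zpow (int n))) (zpow (int n)))"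
  unfolding hardy_proj_def
proof (rule suminf_finite)
  fix n assume "n \<notin> {..k}"
  then have "cinner v (zpow (int k - int n)) = 0" using v by (simp add: H2_iff)
  moreover have "cinner (L2_cnj v \<cdot> zpow (int k)) (zpow (int n)) = cnj (cinner v (zpow (int k - int n)))"
    using cinner_mult_zpow[of "int n" v "int k"] cinner_unimodular_adjoint[OF v(2), of "zpow (int n)" "zpow (int k)"]
      cinner_commute[of "L2_cnj v \<cdot> zpow (int k)" "zpow (int n)"]
    by (simp add: L2_mult_commute)
  moreover have "cscale 0 x = 0" for x
    using norm_cscale[of 0 x] by simp
  ultimately show "cscale (cinner (L2_cnj v \<cdot> zpow (int k)) (zpow (int n))) (zpow (int n)) = 0" by simp
qed simp

lemma essentially_bounded_zero: "essentially_bounded 0"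
  using essentially_bounded_cscale[OF essentially_bounded_zpow[of 0], of 0] norm_cscale[of 0 "zpow 0"] by simp

lemma essentially_bounded_sum:
  "(\<And>i. i \<in> I \<Longrightarrow> essentially_bounded (f i)) \<Longrightarrow> essentially_bounded (sum f I)"
  by (induction I rule: infinite_finite_induct) (auto simp: essentially_bounded_zero essentially_bounded_add)

lemma essentially_bounded_diff:
  assumes "essentially_bounded f" "essentially_bounded g"
  shows "essentially_bounded (f - g)"
proof -
  have eq: "f - g = f + cscale (-1) g"
    by (cases f; cases g) (simp add: L2_abs_eq cscale.abs_eq square_integrable_scale[of _ "-1", simplified])
  show ?thesis unfolding eq using assms by (intro essentially_bounded_add essentially_bounded_cscale)
qed

lemma bounded_model_space_diff:
  "f \<in> bounded_model_space u \<Longrightarrow> g \<in> bounded_model_space u \<Longrightarrow> f - g \<in> bounded_model_space u"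
  by (simp add: bounded_model_space_def model_space_diff essentially_bounded_diff)

text \<open>By the formula for the projection, \<open>P_v z^k\<close> is \<open>z^k\<close> minus
  \<open>v\<close> times a polynomial, and \<open>v\<close> is unimodular.\<close>

lemma orth_proj_zpow_bounded:
  assumes "inner_function v"
  shows "orth_proj (model_space v) (zpow (int k)) \<in> bounded_model_space v"
proof -
  have v: "v \<in> H2" "unimodular v" using assms by (simp_all add: inner_function_def)
  have "essentially_bounded (hardy_proj (L2_cnj v \<cdot> zpow (int k)))"
    unfolding hardy_proj_analytic_polynomial[OF v]
    by (intro essentially_bounded_sum essentially_bounded_cscale essentially_bounded_zpow)
  then have "essentially_bounded (zpow (int k) - v \<cdot> hardy_proj (L2_cnj v \<cdot> zpow (int k)))"
    using v by (intro essentially_bounded_diff essentially_bounded_unimodular_mult essentially_bounded_zpow)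
  then show ?thesis
    using orth_proj_model_space(2)[OF assms, of "zpow (int k)"]
    by (simp add: bounded_model_space_def orth_proj_model_space(1)[OF assms] hardy_proj_H2_eq zpow_H2)
qed

lemma orth_proj_polynomial_bounded:
  assumes "inner_function v"
  shows "orth_proj (model_space v) (\<Sum>n<N. cscale (c n) (zpow (int n))) \<in> bounded_model_space v"
proof -
  define P where "P = orth_proj (model_space v)"
  have "P (\<Sum>n<N. cscale (c n) (zpow (int n))) = (\<Sum>n<N. cscale (c n) (P (zpow (int n))))"
    unfolding P_def
  proof (rule orth_proj_model_space_eqI)
    have K: "sum g I \<in> model_space v" if "\<And>i. i \<in> I \<Longrightarrow> g i \<in> model_space v" for g and I :: "nat set"
      using that
    proof (induction I rule: infinite_finite_induct)
      case empty
      show ?case by (simp add: model_space_def H2_iff cinner_zero_left)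
    next
      case (infinite A)
      then show ?case by (simp add: model_space_def H2_iff cinner_zero_left)
    qed (auto intro: model_space_add)
    show "(\<Sum>n<N. cscale (c n) (orth_proj (model_space v) (zpow (int n)))) \<in> model_space v"
      by (intro K model_space_cscale orth_proj_model_space assms)
    fix h assume h: "h \<in> model_space v"
    have "cinner (zpow (int n)) h = cinner (orth_proj (model_space v) (zpow (int n))) h" for n
      using orth_proj_model_space(3)[OF assms h, of "zpow (int n)"] by (simp add: cinner_diff_left)
    then show "cinner ((\<Sum>n<N. cscale (c n) (zpow (int n))) -
        (\<Sum>n<N. cscale (c n) (orth_proj (model_space v) (zpow (int n))))) h = 0"
      by (simp add: cinner_diff_left cinner_sum_left cinner_cscale_left)
  qed
  moreover have "essentially_bounded (\<Sum>n<N. cscale (c n) (P (zpow (int n))))"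
    using orth_proj_zpow_bounded[OF assms]
    by (intro essentially_bounded_sum essentially_bounded_cscale) (simp add: P_def bounded_model_space_def)
  ultimately show ?thesis
    using orth_proj_model_space(2)[OF assms, of "\<Sum>n<N. cscale (c n) (zpow (int n))"]
    by (simp add: bounded_model_space_def P_def)
qed

text \<open>The projection is a contraction that fixes \<open>f\<close>, so the projected partial
  sums of the Fourier series of \<open>f\<close> still converge to \<open>f\<close>, and they are
  bounded functions.\<close>

lemma model_space_closure_bounded:
  assumes v: "inner_function v" and f: "f \<in> model_space v"
  shows "f \<in> closure (bounded_model_space v)"
proof -
  define p where "p N = (\<Sum>n<N. cscale (cinner f (zpow (int n))) (zpow (int n)))" for N
  have "f \<in> H2" using f by (simp add: model_space_def)
  then have "(\<lambda>n. cscale (cinner f (zpow (int n))) (zpow (int n))) sums f"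
    using summable_sums[OF summable_hardy_proj, of f] hardy_proj_H2_eq[of f] by (simp add: hardy_proj_def)
  then have p: "p \<longlonglongrightarrow> f" by (simp add: sums_def p_def[abs_def])
  have Pf: "orth_proj (model_space v) f = f"
    by (rule orth_proj_model_space_eqI[OF f]) (simp add: cinner_zero_left)
  have "norm (orth_proj (model_space v) (p N) - f) \<le> norm (p N - f)" for N
    using norm_orth_proj_model_space_le[OF v, of "p N - f"] by (simp add: orth_proj_model_space_diff[OF v] Pf)
  moreover have "(\<lambda>N. norm (p N - f)) \<longlonglongrightarrow> 0"
    using p by (simp add: tendsto_norm_zero_iff flip: Lim_null)
  ultimately have "(\<lambda>N. orth_proj (model_space v) (p N) - f) \<longlonglongrightarrow> 0"
    by (rule Lim_null_comparison[OF always_eventually[OF allI]])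
  then have "(\<lambda>N. orth_proj (model_space v) (p N)) \<longlonglongrightarrow> f"
    by (simp flip: Lim_null)
  moreover have "orth_proj (model_space v) (p N) \<in> bounded_model_space v" for N
    unfolding p_def by (rule orth_proj_polynomial_bounded[OF v])
  ultimately show ?thesis
    unfolding closure_sequential by (intro exI[of _ "\<lambda>N. orth_proj (model_space v) (p N)"]) simp
qed

section \<open>Truncated Hankel and Toeplitz operators\<close>

lemma inner_unimodular: "inner_function u \<Longrightarrow> unimodular u"
  by (simp add: inner_function_def)

lemma cinner_flip_zpow: "cinner (flip f) (zpow n) = cinner f (zpow (- n - 1))"
  by (simp add: flip_eq cinner_L2_hat_zpow cinner_L2_conj_zpow)

text \<open>The flip interchanges \<open>H2\<close> with its orthogonal complement, so \<open>J (I - P) = P J\<close>.\<close>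

lemma hankel_pre_eq:
  assumes "inner_function v"
  shows "hankel_pre u v \<phi> f = orth_proj (model_space v) (flip (\<phi> \<cdot> f))"
proof -
  define x where "x = \<phi> \<cdot> f"
  have "flip (x - hardy_proj x) = flip x - flip (hardy_proj x)"
    by (simp add: flip_eq antiunitary_diff[OF antiunitary_L2_conj] antiunitary_diff[OF antiunitary_L2_hat])
  moreover have "orth_proj (model_space v) (flip (hardy_proj x)) = 0"
  proof (rule orth_proj_model_space_eqI)
    show "0 \<in> model_space v" by (simp add: model_space_def H2_iff cinner_zero_left)
    fix h assume "h \<in> model_space v"
    then have "h \<in> H2" by (simp add: model_space_def)
    then show "cinner (flip (hardy_proj x) - 0) h = 0"
      by (rule H2_orthogonalI[rotated]) (simp add: cinner_flip_zpow cinner_hardy_proj)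
  qed
  ultimately show ?thesis
    by (simp add: hankel_pre_def orth_proj_H2 orth_proj_model_space_diff[OF assms] flip: x_def)
qed

text \<open>Restricted to bounded arguments, where multiplication by \<open>\<phi>\<close> is
  genuine. This replaces linearity in the extension argument.\<close>

lemma hankel_pre_diff:
  assumes "inner_function v" "f \<in> bounded_model_space u" "g \<in> bounded_model_space u"
  shows "hankel_pre u v \<phi> (f - g) = hankel_pre u v \<phi> f - hankel_pre u v \<phi> g"
proof -
  have "\<phi> \<cdot> f = \<phi> \<cdot> (f - g) + \<phi> \<cdot> g"
    using L2_mult_essentially_bounded_add[of "f - g" g \<phi>] assms
    by (simp add: bounded_model_space_def essentially_bounded_diff)
  then have "\<phi> \<cdot> (f - g) = \<phi> \<cdot> f - \<phi> \<cdot> g" by simp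
  then show ?thesis
    by (simp add: hankel_pre_eq[OF assms(1)] flip_eq antiunitary_diff[OF antiunitary_L2_conj]
        antiunitary_diff[OF antiunitary_L2_hat] orth_proj_model_space_diff[OF assms(1)])
qed

text \<open>After the flip, the outer hat leaves only \<open>L2_conj\<close>, which turns
  multiplication of \<open>L2_conj f\<close> by \<open>u \<cdot> \<phi>\<close> into multiplication
  of \<open>f\<close> by the conjugate symbol. The hat also carries \<open>P_v\<close> to the
  projection for \<open>L2_hat v\<close>.\<close>

lemma toeplitz_pre_eq_hankel_pre:
  assumes "inner_function u" "inner_function v"
  shows "toeplitz_pre u (L2_hat v) (L2_cnj (u \<cdot> \<phi>)) f = L2_hat (hankel_pre u v \<phi> (model_conj u f))"
proof -
  have "L2_hat (flip (\<phi> \<cdot> model_conj u f)) = L2_conj (\<phi> \<cdot> (u \<cdot> L2_conj f))"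
    by (simp add: flip_eq L2_hat_hat model_conj_def)
  also have "\<phi> \<cdot> (u \<cdot> L2_conj f) = (u \<cdot> \<phi>) \<cdot> L2_conj f"
    by (simp only: L2_mult_unimodular_left_commute[OF inner_unimodular[OF assms(1)]]
        L2_mult_unimodular_assoc[OF inner_unimodular[OF assms(1)]])
  also have "L2_conj \<dots> = L2_cnj (u \<cdot> \<phi>) \<cdot> f"
    by (simp add: L2_conj_mult L2_conj_conj)
  finally show ?thesis
    by (simp add: toeplitz_pre_def hankel_pre_eq[OF assms(2)] flip: orth_proj_L2_hat[OF assms(2)])
qed

text \<open>\<open>C_v\<close> composed with the flip is the hat followed by multiplication by
  \<open>v\<close>, and \<open>C_v\<close> commutes with \<open>P_v\<close>.\<close>

lemma toeplitz_pre_hat_eq_hankel_pre: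
  assumes "inner_function u" "inner_function v"
  shows "toeplitz_pre (L2_hat u) v (v \<cdot> L2_hat \<phi>) f = model_conj v (hankel_pre u v \<phi> (L2_hat f))"
proof -
  have "model_conj v (flip (\<phi> \<cdot> L2_hat f)) = v \<cdot> (L2_hat \<phi> \<cdot> f)"
    by (simp add: model_conj_def flip_eq L2_hat_conj L2_conj_conj L2_hat_mult L2_hat_hat)
  also have "\<dots> = (v \<cdot> L2_hat \<phi>) \<cdot> f"
    using inner_unimodular[OF assms(2)] by (simp add: L2_mult_unimodular_assoc)
  finally show ?thesis
    by (simp add: toeplitz_pre_def hankel_pre_eq[OF assms(2)] flip: orth_proj_model_conj[OF assms(2)])
qed

lemma hankel_pre_conj:
  assumes "inner_function u" "inner_function v"
  shows "hankel_pre u v (L2_cnj (u \<cdot> L2_hat v \<cdot> \<phi>)) f = model_conj v (hankel_pre u v \<phi> (model_conj u f))"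
proof -
  note u = inner_unimodular[OF assms(1)] and v = inner_unimodular[OF assms(2)]
  have "\<phi> \<cdot> model_conj u f = (u \<cdot> \<phi>) \<cdot> L2_conj f"
    by (simp only: model_conj_def L2_mult_unimodular_left_commute[OF u] L2_mult_unimodular_assoc[OF u])
  then have "model_conj v (flip (\<phi> \<cdot> model_conj u f)) = v \<cdot> (L2_hat (u \<cdot> \<phi>) \<cdot> L2_hat (L2_conj f))"
    by (simp only: model_conj_def flip_eq L2_hat_conj L2_conj_conj L2_hat_mult[of "u \<cdot> \<phi>"])
  \<comment> \<open>Moving \<open>v\<close> inside the hat turns it into \<open>L2_hat v\<close>;
    this is where that factor of the symbol comes from.\<close>
  also have "\<dots> = L2_hat (L2_hat v \<cdot> (u \<cdot> \<phi>)) \<cdot> L2_hat (L2_conj f)"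
    by (simp only: L2_hat_mult[of "L2_hat v"] L2_hat_hat L2_mult_unimodular_assoc[OF v])
  also have "L2_hat v \<cdot> (u \<cdot> \<phi>) = u \<cdot> L2_hat v \<cdot> \<phi>"
    by (simp only: L2_mult_unimodular_left_commute[OF u] L2_mult_unimodular_assoc[OF u])
  also have "L2_hat (u \<cdot> L2_hat v \<cdot> \<phi>) \<cdot> L2_hat (L2_conj f) = flip (L2_cnj (u \<cdot> L2_hat v \<cdot> \<phi>) \<cdot> f)"
    by (simp only: flip_eq L2_conj_mult L2_cnj_cnj L2_hat_mult)
  finally show ?thesis
    by (simp add: hankel_pre_eq[OF assms(2)] flip: orth_proj_model_conj[OF assms(2)])
qed

lemma hankel_pre_hat:
  assumes "inner_function v"
  shows "hankel_pre (L2_hat u) (L2_hat v) (L2_hat \<phi>) f = L2_hat (hankel_pre u v \<phi> (L2_hat f))"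
proof -
  have "L2_hat (flip (\<phi> \<cdot> L2_hat f)) = flip (L2_hat \<phi> \<cdot> f)"
    by (simp add: flip_eq L2_hat_hat L2_hat_conj L2_hat_mult)
  then show ?thesis
    by (simp add: hankel_pre_eq[OF assms] hankel_pre_eq[OF inner_function_hat[OF assms]]
        flip: orth_proj_L2_hat[OF assms])
qed

section \<open>Extension by continuity\<close>

text \<open>Limits are unique only along a proper filter; density makes the filter in
  \<open>extend_operator\<close> proper, so \<open>Lim\<close> picks out the limit.\<close>

lemma nhds_principal_neq_bot:
  assumes "x \<in> closure S"
  shows "inf (nhds x) (principal S) \<noteq> bot"
proof
  assume "inf (nhds x) (principal S) = bot"
  then have "eventually (\<lambda>_. False) (inf (nhds x) (principal S))" by simp
  then obtain U where U: "open U" "x \<in> U" "U \<inter> S = {}"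
    by (auto simp: eventually_inf_principal eventually_nhds)
  then show False using assms open_Int_closure_eq_empty[of U S] by blast
qed

text \<open>A bounded operator compatible with differences is uniformly continuous on the bounded
  functions, hence extends continuously to their closure, which contains the model space.\<close>

lemma extend_operator_tendsto:
  assumes u: "inner_function u" and T: "bounded_operator u T"
    and diff: "\<And>f g. f \<in> bounded_model_space u \<Longrightarrow> g \<in> bounded_model_space u \<Longrightarrow> T (f - g) = T f - T g"
    and f: "f \<in> model_space u"
  shows "(T \<longlongrightarrow> extend_operator u T f) (inf (nhds f) (principal (bounded_model_space u)))"
    (is "(T \<longlongrightarrow> _) ?F")
proof -
  let ?B = "bounded_model_space u"
  obtain C where C: "\<And>g. g \<in> ?B \<Longrightarrow> norm (T g) \<le> C * norm g"
    using T by (auto simp: bounded_operator_def)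
  have "uniformly_continuous_on ?B T"
    unfolding uniformly_continuous_on_def
  proof (intro allI impI)
    fix e :: real assume e: "e > 0"
    show "\<exists>d>0. \<forall>x\<in>?B. \<forall>x'\<in>?B. dist x' x < d \<longrightarrow> dist (T x') (T x) < e"
    proof (intro exI conjI ballI impI)
      \<comment> \<open>The constant \<open>C\<close> may be zero or negative;
        \<open>\<bar>C\<bar> + 1\<close> is a safe divisor.\<close>
      show "e / (\<bar>C\<bar> + 1) > 0" using e by simp
      fix x x' assume x: "x \<in> ?B" "x' \<in> ?B" and d: "dist x' x < e / (\<bar>C\<bar> + 1)"
      have "norm (T x' - T x) \<le> C * norm (x' - x)"
        using C[OF bounded_model_space_diff[OF x(2,1)]] by (simp add: diff x)
      also have "\<dots> \<le> (\<bar>C\<bar> + 1) * norm (x' - x)" by (intro mult_right_mono) auto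
      also have "\<dots> < e" using d by (simp add: dist_norm field_simps)
      finally show "dist (T x') (T x) < e" by (simp add: dist_norm)
    qed
  qed
  then obtain g where g: "uniformly_continuous_on (closure ?B) g" "\<And>x. x \<in> ?B \<Longrightarrow> T x = g x"
    by (rule uniformly_continuous_on_extension_on_closure) blast
  have fc: "f \<in> closure ?B" by (rule model_space_closure_bounded[OF u f])
  \<comment> \<open>Unlike a punctured limit, this filter sees the point \<open>f\<close> itself;
    continuity of \<open>g\<close> controls the value there as well.\<close>
  have "(g \<longlongrightarrow> g f) (inf (nhds f) (principal (closure ?B)))"
    using uniformly_continuous_imp_continuous[OF g(1)] fc
    by (simp add: continuous_on_def tendsto_at_within_iff_tendsto_nhds)
  then have "(g \<longlongrightarrow> g f) ?F"
    by (rule tendsto_mono[rotated]) (intro inf_mono order_refl, simp add: closure_subset)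
  moreover have "\<forall>\<^sub>F x in ?F. g x = T x"
    using g(2) by (simp add: eventually_inf_principal)
  ultimately have lim: "(T \<longlongrightarrow> g f) ?F"
    by (simp add: tendsto_cong)
  moreover have "?F \<noteq> bot" by (rule nhds_principal_neq_bot[OF fc])
  ultimately show ?thesis
    unfolding extend_operator_def by (simp add: tendsto_Lim)
qed

lemma extend_operator_in_model_space:
  assumes u: "inner_function u" and v: "unimodular v" and T: "bounded_operator u T"
    and diff: "\<And>f g. f \<in> bounded_model_space u \<Longrightarrow> g \<in> bounded_model_space u \<Longrightarrow> T (f - g) = T f - T g"
    and range: "\<And>f. T f \<in> model_space v"
    and f: "f \<in> model_space u"
  shows "extend_operator u T f \<in> model_space v"
proof (rule Lim_in_closed_set[OF closed_model_space[OF v] _ _ extend_operator_tendsto[OF u T diff f]])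
  show "inf (nhds f) (principal (bounded_model_space u)) \<noteq> bot"
    by (rule nhds_principal_neq_bot[OF model_space_closure_bounded[OF u f]])
qed (simp_all add: range)

lemma bounded_operator_transfer:
  assumes V: "antiunitary V" and W: "antiunitary W"
    and WB: "\<And>f. f \<in> bounded_model_space u \<Longrightarrow> W f \<in> bounded_model_space u'"
    and T: "bounded_operator u' T" and S: "\<And>f. S f = V (T (W f))"
  shows "bounded_operator u S"
proof -
  obtain C where "\<And>g. g \<in> bounded_model_space u' \<Longrightarrow> norm (T g) \<le> C * norm g"
    using T by (auto simp: bounded_operator_def)
  then have "\<forall>f\<in>bounded_model_space u. norm (S f) \<le> C * norm f"
    using WB by (metis S antiunitary_norm V W)
  then show ?thesis by (auto simp: bounded_operator_def)
qed

text \<open>\<open>W\<close> maps the filter at \<open>f\<close> into the one at \<open>W f\<close>,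
  and \<open>V\<close> is continuous. An identity on the pre-operators thus survives the passage to
  the limit.\<close>

lemma extend_operator_transfer:
  assumes V: "antiunitary V" and W: "antiunitary W"
    and WB: "\<And>f. f \<in> bounded_model_space u \<Longrightarrow> W f \<in> bounded_model_space u'"
    and u: "inner_function u" "inner_function u'"
    and T: "bounded_operator u' T"
    and diff: "\<And>f g. f \<in> bounded_model_space u' \<Longrightarrow> g \<in> bounded_model_space u' \<Longrightarrow> T (f - g) = T f - T g"
    and S: "\<And>f. S f = V (T (W f))"
    and f: "f \<in> model_space u" "W f \<in> model_space u'"
  shows "extend_operator u S f = V (extend_operator u' T (W f))"
proof -
  let ?F = "inf (nhds f) (principal (bounded_model_space u))"
  have "((\<lambda>x. x) \<longlongrightarrow> f) ?F" by (rule tendsto_mono[OF inf_le1]) (simp add: filterlim_ident)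
  then have "(W \<longlongrightarrow> W f) ?F" by (rule antiunitary_tendsto[OF W])
  moreover have "filterlim W (principal (bounded_model_space u')) ?F"
    using WB by (simp add: filterlim_principal eventually_inf_principal)
  ultimately have "filterlim W (inf (nhds (W f)) (principal (bounded_model_space u'))) ?F"
    by (simp add: filterlim_inf)
  with extend_operator_tendsto[OF u(2) T diff f(2)]
  have "((\<lambda>x. T (W x)) \<longlongrightarrow> extend_operator u' T (W f)) ?F"
    by (rule filterlim_compose)
  then have "((\<lambda>x. V (T (W x))) \<longlongrightarrow> V (extend_operator u' T (W f))) ?F"
    by (rule antiunitary_tendsto[OF V])
  moreover have "S = (\<lambda>x. V (T (W x)))" using S by blast
  moreover have "?F \<noteq> bot"
    by (rule nhds_principal_neq_bot[OF model_space_closure_bounded[OF u(1) f(1)]])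
  ultimately show ?thesis unfolding extend_operator_def[of u S] by (simp add: tendsto_Lim)
qed

section \<open>Symmetries of the extended operators\<close>

context
  fixes u v \<phi> :: L2
  assumes u: "inner_function u" and v: "inner_function v"
    and bdd: "bounded_operator u (hankel_pre u v \<phi>)"
begin

lemma hankel_op_in_model_space: "f \<in> model_space u \<Longrightarrow> hankel_op u v \<phi> f \<in> model_space v"
  unfolding hankel_op_def
proof (rule extend_operator_in_model_space[OF u inner_unimodular[OF v] bdd])
  show "hankel_pre u v \<phi> g \<in> model_space v" for g
    by (simp add: hankel_pre_eq[OF v] orth_proj_model_space(2)[OF v])
qed (rule hankel_pre_diff[OF v])

lemma toeplitz_op_eq_hankel_op:
  shows "bounded_operator u (toeplitz_pre u (L2_hat v) (L2_cnj (u \<cdot> \<phi>)))"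
    and "f \<in> model_space u \<Longrightarrow>
      toeplitz_op u (L2_hat v) (L2_cnj (u \<cdot> \<phi>)) f = L2_hat (hankel_op u v \<phi> (model_conj u f))"
proof -
  note uu = inner_unimodular[OF u]
  note VW = antiunitary_L2_hat antiunitary_model_conj[OF uu] bounded_model_conj[OF uu]
  show "bounded_operator u (toeplitz_pre u (L2_hat v) (L2_cnj (u \<cdot> \<phi>)))"
    by (rule bounded_operator_transfer[where V = L2_hat, OF VW bdd], assumption, rule toeplitz_pre_eq_hankel_pre[OF u v])
  show "toeplitz_op u (L2_hat v) (L2_cnj (u \<cdot> \<phi>)) f = L2_hat (hankel_op u v \<phi> (model_conj u f))"
    if "f \<in> model_space u"
    unfolding toeplitz_op_def hankel_op_def using that
    by (intro extend_operator_transfer[where V = L2_hat, OF VW u u bdd])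
      (simp_all add: hankel_pre_diff[OF v] toeplitz_pre_eq_hankel_pre[OF u v] model_conj_model_space uu)
qed

lemma toeplitz_op_hat_eq_hankel_op:
  assumes "f \<in> model_space (L2_hat u)"
  shows "toeplitz_op (L2_hat u) v (v \<cdot> L2_hat \<phi>) f = model_conj v (hankel_op u v \<phi> (L2_hat f))"
proof -
  note uu = inner_unimodular[OF u]
  note VW = antiunitary_model_conj[OF inner_unimodular[OF v]] antiunitary_L2_hat bounded_L2_hat'[OF uu]
  show ?thesis
    unfolding toeplitz_op_def hankel_op_def using assms
    by (intro extend_operator_transfer[where V = "model_conj v", OF VW inner_function_hat[OF u] u bdd])
      (simp_all add: hankel_pre_diff[OF v] toeplitz_pre_hat_eq_hankel_pre[OF u v] L2_hat_model_space' uu)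
qed

lemma hankel_op_conj:
  shows "bounded_operator u (hankel_pre u v (L2_cnj (u \<cdot> L2_hat v \<cdot> \<phi>)))"
    and "f \<in> model_space u \<Longrightarrow>
      hankel_op u v (L2_cnj (u \<cdot> L2_hat v \<cdot> \<phi>)) f = model_conj v (hankel_op u v \<phi> (model_conj u f))"
proof -
  note uu = inner_unimodular[OF u]
  note VW = antiunitary_model_conj[OF inner_unimodular[OF v]] antiunitary_model_conj[OF uu]
    bounded_model_conj[OF uu]
  show "bounded_operator u (hankel_pre u v (L2_cnj (u \<cdot> L2_hat v \<cdot> \<phi>)))"
    by (rule bounded_operator_transfer[where V = "model_conj v", OF VW bdd], assumption, rule hankel_pre_conj[OF u v])
  show "hankel_op u v (L2_cnj (u \<cdot> L2_hat v \<cdot> \<phi>)) f = model_conj v (hankel_op u v \<phi> (model_conj u f))"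
    if "f \<in> model_space u"
    unfolding hankel_op_def
    by (rule extend_operator_transfer[where V = "model_conj v", OF VW u u bdd hankel_pre_diff[OF v]
          hankel_pre_conj[OF u v] that model_conj_model_space[OF uu that]])
qed

lemma hankel_op_hat:
  shows "bounded_operator (L2_hat u) (hankel_pre (L2_hat u) (L2_hat v) (L2_hat \<phi>))"
    and "f \<in> model_space (L2_hat u) \<Longrightarrow>
      hankel_op (L2_hat u) (L2_hat v) (L2_hat \<phi>) f = L2_hat (hankel_op u v \<phi> (L2_hat f))"
proof -
  note uu = inner_unimodular[OF u]
  note VW = antiunitary_L2_hat antiunitary_L2_hat bounded_L2_hat'[OF uu]
  show "bounded_operator (L2_hat u) (hankel_pre (L2_hat u) (L2_hat v) (L2_hat \<phi>))"
    by (rule bounded_operator_transfer[where V = L2_hat, OF VW bdd], assumption, rule hankel_pre_hat[OF v])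
  show "hankel_op (L2_hat u) (L2_hat v) (L2_hat \<phi>) f = L2_hat (hankel_op u v \<phi> (L2_hat f))"
    if "f \<in> model_space (L2_hat u)"
    unfolding hankel_op_def
    by (rule extend_operator_transfer[where V = L2_hat, OF VW inner_function_hat[OF u] u bdd hankel_pre_diff[OF v]
          hankel_pre_hat[OF v] that L2_hat_model_space'[OF uu that]])
qed

end

section \<open>Invariance of the operator spaces under the symmetries\<close>

lemma hankel_space_conj:
  assumes u: "inner_function u" and w: "inner_function w" and T: "T \<in> hankel_space u w"
    and T': "\<And>f. f \<in> model_space u \<Longrightarrow> T' f = model_conj w (T (model_conj u f))"
  shows "T' \<in> hankel_space u w"
proof -
  obtain \<phi> where b: "bounded_operator u (hankel_pre u w \<phi>)"
    and eq: "\<And>f. f \<in> model_space u \<Longrightarrow> T f = hankel_op u w \<phi> f"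
    using T by (auto simp: hankel_space_def)
  have "\<forall>f\<in>model_space u. T' f = hankel_op u w (L2_cnj (u \<cdot> L2_hat w \<cdot> \<phi>)) f"
    by (simp add: T' eq hankel_op_conj(2)[OF u w b] model_conj_model_space inner_unimodular u)
  with hankel_op_conj(1)[OF u w b] show ?thesis by (auto simp: hankel_space_def)
qed

lemma hankel_space_hat:
  assumes u: "inner_function u" and w: "inner_function w" and T: "T \<in> hankel_space u w"
    and T': "\<And>f. f \<in> model_space (L2_hat u) \<Longrightarrow> T' f = L2_hat (T (L2_hat f))"
  shows "T' \<in> hankel_space (L2_hat u) (L2_hat w)"
proof -
  obtain \<phi> where b: "bounded_operator u (hankel_pre u w \<phi>)"
    and eq: "\<And>f. f \<in> model_space u \<Longrightarrow> T f = hankel_op u w \<phi> f"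
    using T by (auto simp: hankel_space_def)
  have "\<forall>f\<in>model_space (L2_hat u). T' f = hankel_op (L2_hat u) (L2_hat w) (L2_hat \<phi>) f"
    by (simp add: T' eq hankel_op_hat(2)[OF u w b] L2_hat_model_space' inner_unimodular u)
  with hankel_op_hat(1)[OF u w b] show ?thesis by (auto simp: hankel_space_def)
qed

lemma toeplitz_space_hat_iff:
  assumes u: "inner_function u" and w: "inner_function w"
    and T': "\<And>f. f \<in> model_space u \<Longrightarrow> T' f = L2_hat (T (model_conj u f))"
  shows "T' \<in> toeplitz_space u (L2_hat w) \<longleftrightarrow> T \<in> hankel_space u w"
proof
  note uu = inner_unimodular[OF u]
  assume "T \<in> hankel_space u w"
  then obtain \<phi> where b: "bounded_operator u (hankel_pre u w \<phi>)"
    and eq: "\<And>f. f \<in> model_space u \<Longrightarrow> T f = hankel_op u w \<phi> f"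
    by (auto simp: hankel_space_def)
  have "\<forall>f\<in>model_space u. T' f = toeplitz_op u (L2_hat w) (L2_cnj (u \<cdot> \<phi>)) f"
    by (simp add: T' eq toeplitz_op_eq_hankel_op(2)[OF u w b] model_conj_model_space uu)
  with toeplitz_op_eq_hankel_op(1)[OF u w b] show "T' \<in> toeplitz_space u (L2_hat w)"
    by (auto simp: toeplitz_space_def)
next
  note uu = inner_unimodular[OF u]
  assume "T' \<in> toeplitz_space u (L2_hat w)"
  then obtain \<psi> where b: "bounded_operator u (toeplitz_pre u (L2_hat w) \<psi>)"
    and eq: "\<And>f. f \<in> model_space u \<Longrightarrow> T' f = toeplitz_op u (L2_hat w) \<psi> f"
    by (auto simp: toeplitz_space_def)
  \<comment> \<open>Solves \<open>\<psi> = L2_cnj (u \<cdot> \<phi>)\<close> for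
    \<open>\<phi>\<close>, which is possible since \<open>u\<close> is unimodular: every Toeplitz
    symbol arises from a Hankel symbol.\<close>
  define \<phi> where "\<phi> = L2_cnj u \<cdot> L2_cnj \<psi>"
  have \<psi>: "\<psi> = L2_cnj (u \<cdot> \<phi>)"
    by (simp add: \<phi>_def unimodular_mult_cnj[OF uu] L2_cnj_cnj)
  have pre: "hankel_pre u w \<phi> f = L2_hat (toeplitz_pre u (L2_hat w) \<psi> (model_conj u f))" for f
    by (simp add: \<psi> toeplitz_pre_eq_hankel_pre[OF u w] L2_hat_hat model_conj_conj[OF uu])
  have b': "bounded_operator u (hankel_pre u w \<phi>)"
    by (rule bounded_operator_transfer[where V = L2_hat,
          OF antiunitary_L2_hat antiunitary_model_conj[OF uu] bounded_model_conj[OF uu] b], assumption, rule pre)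
  have "T f = hankel_op u w \<phi> f" if f: "f \<in> model_space u" for f
  proof -
    have "L2_hat (T f) = L2_hat (hankel_op u w \<phi> f)"
      using T'[OF model_conj_model_space[OF uu f]] eq[OF model_conj_model_space[OF uu f]]
        toeplitz_op_eq_hankel_op(2)[OF u w b' model_conj_model_space[OF uu f]]
      by (simp add: model_conj_conj[OF uu] flip: \<psi>)
    then show ?thesis by (metis L2_hat_hat)
  qed
  with b' show "T \<in> hankel_space u w" by (auto simp: hankel_space_def)
qed

theorem proposition3p5:
  fixes u v w \<phi>\<^sub>1 \<phi>\<^sub>2 :: L2
  assumes "inner_function u" and "nonconstant u"
    and "inner_function v" and "nonconstant v"
    and "inner_function w" and "nonconstant w"
    and "bounded_operator v (hankel_pre v w \<phi>\<^sub>1)"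
    and "bounded_operator u (hankel_pre u v \<phi>\<^sub>2)"
  shows
    "(hankel_op v w \<phi>\<^sub>1 \<circ> hankel_op u v \<phi>\<^sub>2 \<in> hankel_space u w
      \<longleftrightarrow> toeplitz_op (L2_hat v) w (w \<cdot> L2_hat \<phi>\<^sub>1) \<circ>
          toeplitz_op u (L2_hat v) (L2_cnj (u \<cdot> \<phi>\<^sub>2)) \<in> hankel_space u w) \<and>
     (hankel_op v w \<phi>\<^sub>1 \<circ> hankel_op u v \<phi>\<^sub>2 \<in> hankel_space u w
      \<longleftrightarrow> toeplitz_op v (L2_hat w) (L2_cnj (v \<cdot> \<phi>\<^sub>1)) \<circ>
          toeplitz_op (L2_hat u) v (v \<cdot> L2_hat \<phi>\<^sub>2) \<in> hankel_space (L2_hat u) (L2_hat w)) \<and>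
     (hankel_op v w \<phi>\<^sub>1 \<circ> hankel_op u v \<phi>\<^sub>2 \<in> hankel_space u w
      \<longleftrightarrow> toeplitz_op v (L2_hat w) (L2_cnj (v \<cdot> \<phi>\<^sub>1)) \<circ>
          hankel_op u v (L2_cnj (u \<cdot> L2_hat v \<cdot> \<phi>\<^sub>2)) \<in> toeplitz_space u (L2_hat w))"
    (is "(?B \<in> _ \<longleftrightarrow> ?T2 \<in> _) \<and> (_ \<longleftrightarrow> ?T3 \<in> _) \<and> (_ \<longleftrightarrow> ?T4 \<in> _)")
proof -
  note u = assms(1) and v = assms(3) and w = assms(5) and b1 = assms(7) and b2 = assms(8)
  note uu = inner_unimodular[OF u] and uv = inner_unimodular[OF v] and uw = inner_unimodular[OF w]
  \<comment> \<open>The formulas for the left factors hold on the model space only, so the right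
    factors must take values there.\<close>
  have range: "hankel_op u v \<phi>\<^sub>2 f \<in> model_space v" if "f \<in> model_space u" for f
    using hankel_op_in_model_space[OF u v b2 that] .
  \<comment> \<open>The right factor ends with a hat and the left one begins with a hat; the two
    cancel.\<close>
  have T2: "?T2 f = model_conj w (?B (model_conj u f))" if "f \<in> model_space u" for f
    using that
    by (simp add: toeplitz_op_eq_hankel_op(2)[OF u v b2] toeplitz_op_hat_eq_hankel_op[OF v w b1]
        range L2_hat_model_space[OF uv] model_conj_model_space[OF uu] L2_hat_hat)
  \<comment> \<open>Here, and in \<open>T4\<close>, it is the two copies of \<open>C_v\<close> in
    the middle that cancel.\<close>
  have T3: "?T3 f = L2_hat (?B (L2_hat f))" if "f \<in> model_space (L2_hat u)" for f
    using that
    by (simp add: toeplitz_op_hat_eq_hankel_op[OF u v b2] toeplitz_op_eq_hankel_op(2)[OF v w b1]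
        range L2_hat_model_space'[OF uu] model_conj_model_space[OF uv] model_conj_conj[OF uv])
  have T4: "?T4 f = L2_hat (?B (model_conj u f))" if "f \<in> model_space u" for f
    using that
    by (simp add: hankel_op_conj(2)[OF u v b2] toeplitz_op_eq_hankel_op(2)[OF v w b1]
        range model_conj_model_space[OF uu] model_conj_model_space[OF uv] model_conj_conj[OF uv])
  \<comment> \<open>As the symmetries are involutions, the formula can be solved for
    \<open>?B\<close>, which gives the converse implication.\<close>
  have B2: "?B f = model_conj w (?T2 (model_conj u f))" if "f \<in> model_space u" for f
    unfolding T2[OF model_conj_model_space[OF uu that]] by (simp add: model_conj_conj[OF uu] model_conj_conj[OF uw])
  have B3: "?B f = L2_hat (?T3 (L2_hat f))" if "f \<in> model_space u" for f
    unfolding T3[OF L2_hat_model_space[OF uu that]] by (simp add: L2_hat_hat)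
  have "?B \<in> hankel_space u w \<longleftrightarrow> ?T2 \<in> hankel_space u w"
  proof
    show "?T2 \<in> hankel_space u w" if "?B \<in> hankel_space u w"
      using that by (rule hankel_space_conj[OF u w]) (rule T2)
    show "?B \<in> hankel_space u w" if "?T2 \<in> hankel_space u w"
      using that by (rule hankel_space_conj[OF u w]) (rule B2)
  qed
  moreover have "?B \<in> hankel_space u w \<longleftrightarrow> ?T3 \<in> hankel_space (L2_hat u) (L2_hat w)"
  proof
    show "?T3 \<in> hankel_space (L2_hat u) (L2_hat w)" if "?B \<in> hankel_space u w"
      using that by (rule hankel_space_hat[OF u w]) (rule T3)
    show "?B \<in> hankel_space u w" if "?T3 \<in> hankel_space (L2_hat u) (L2_hat w)"
      \<comment> \<open>Applied to the hatted functions, the same lemma leads back to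
        \<open>u\<close> and \<open>w\<close>, since the hat is an involution.\<close>
      using hankel_space_hat[OF inner_function_hat[OF u] inner_function_hat[OF w] that, of ?B] B3
      by (simp only: L2_hat_hat)
  qed
  moreover have "?B \<in> hankel_space u w \<longleftrightarrow> ?T4 \<in> toeplitz_space u (L2_hat w)"
    by (rule toeplitz_space_hat_iff[OF u w, symmetric]) (rule T4)
  ultimately show ?thesis by blast
qed

end
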